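(* Let $\mathcal{H}$ be a real Hilbert space, let $C_i\subseteq\mathcal{H}$, $i\in I:=\{1,\ldots,M\}$, be closed and convex, and assume that $C:=\bigcap_{i\in I}C_i\neq\emptyset$. For every $k=0,1,2,\ldots$ let $$T_k:=\sum_{n=1}^{N_k}\omega_n^k\prod_{j\in J_n^k}P_{C_j},$$ where $J_n^k\subseteq I$ is a string and $\omega_n^k\in(0,1)$, $\sum_{n=1}^{N_k}\omega_n^k=1$. Let $I_k:=J_1^k\cup\ldots\cup J_{N_k}^k$. Assume that $\omega_n^k\geq\omega$ (for all $k$ and $n$) for some $\omega>0$, that $m:=\sup_k\max_{1\leq n\leq N_k}|J_n^k|<\infty$, and that there is an integer $s\geq1$ such that for each $k=0,1,2,\ldots$ we have $I=I_k\cup\ldots\cup I_{k+s-1}$. Let the sequence $\{x^k\}_{k=0}^\infty$ be a superiorized version of the dynamic string averaging projection method defined by $\{T_k\}_{k=0}^\infty$, that is, $$x^0\in\mathcal{H}\qquad\text{and}\qquad x^{k+1}=T_k(x^k-\beta_kv^k),$$ where $\{\beta_k\}_{k=0}^\infty\subseteq[0,\infty)$ is summable and $\{v^k\}_{k=0}^\infty\subseteq\mathcal{H}$ is bounded. Then the following statements hold true: (i) There are a point $x^\infty\in C$ and, for every $i=0,1,2,\ldots$, a point $x_i^\infty\in C$ such that $T_k\cdots T_ix^i\rightharpoonup x_i^\infty$ as $k\to\infty$ for every $i$, and $x_i^\infty\to x^\infty$ as $i\to\infty$. Moreover, for all $y\in\mathcal{H}$ and all integers $k\geq i\geq0$, $$|\langle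 y,x^{k+1}-x^\infty\rangle|\leq|\langle y,T_k\cdots T_ix^i-x_i^\infty\rangle|+2\|y\|\sum_{j=i}^\infty\beta_j\|v^j\|.$$ (ii) If the family $\{C_i\mid i\in I\}$ is boundedly regular, then there are a point $x^\infty\in C$ and, for every $i=0,1,2,\ldots$, a point $x_i^\infty\in C$ such that $T_k\cdots T_ix^i\to x_i^\infty$ as $k\to\infty$ for every $i$, and $x_i^\infty\to x^\infty$ as $i\to\infty$. Moreover, for all integers $k\geq i\geq0$, $$\|x^{k+1}-x^\infty\|\leq\|T_k\cdots T_ix^i-x_i^\infty\|+2\sum_{j=i}^\infty\beta_j\|v^j\|.$$ (iii) If the family $\{C_i\mid i\in I\}$ is boundedly linearly regular, then there are $\kappa>0$, $c>0$, $q\in(0,1)$ and $x^\infty\in C$ such that for all integers $k\geq i\geq0$, $$\frac{1}{2\kappa}\|x^{k+1}-x^\infty\|-2\sum_{j=i}^\infty\beta_j\|v^j\|\leq\max_{j\in I}d(x^{k+1},C_j)\leq cq^{k-i}+2\sum_{j=i}^\infty\beta_j\|v^j\|.$$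
   Context: $\rightharpoonup$ denotes weak convergence and $\to$ norm convergence. $P_D$ denotes the metric projection onto a nonempty closed convex set $D\subseteq\mathcal{H}$ and $d(x,D)=\inf\{\|x-z\|\mid z\in D\}$. A string is a finite ordered subset $J=(j_1,\ldots,j_l)$ of $I$, of length $|J|=l$, and $\prod_{j\in J}P_{C_j}:=P_{C_{j_l}}\cdots P_{C_{j_1}}$ (composition, $P_{C_{j_1}}$ applied first). For $S\subseteq\mathcal{H}$, the family $\{C_1,\ldots,C_M\}$ of closed convex sets with nonempty intersection $C$ is regular over $S$ if for every sequence $\{y^k\}\subseteq S$, $\max_{i}d(y^k,C_i)\to0$ implies $d(y^k,C)\to0$; it is $\kappa_S$-linearly regular over $S$ if $d(x,C)\leq\kappa_S\max_{i}d(x,C_i)$ for all $x\in S$ and some constant $\kappa_S>0$. The family is boundedly regular (boundedly linearly regular) if it is regular ($\kappa_S$-linearly regular, with $\kappa_S$ possibly depending on $S$) over every bounded subset $S\subseteq\mathcal{H}$. *)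

theory Defs
  imports "HOL-Analysis.Analysis"
begin

text \<open>The Hilbert space is a type of sort \<open>{real_inner, complete_space}\<close>. The library function
  \<open>closest_point\<close> is restricted to \<open>heine_borel\<close>, i.e. to finite dimension, hence the
  following definition. The minimiser exists and is unique when \<open>D\<close> is nonempty, closed and convex.\<close>

definition metric_proj :: "'a::{real_inner,complete_space} set \<Rightarrow> 'a \<Rightarrow> 'a" where
  "metric_proj D x = (THE p. p \<in> D \<and> (\<forall>z\<in>D. dist x p \<le> dist x z))"

definition weakly_converges :: "(nat \<Rightarrow> 'a::real_inner) \<Rightarrow> 'a \<Rightarrow> bool" where
  "weakly_converges x l \<longleftrightarrow> (\<forall>y. (\<lambda>k. y \<bullet> x k) \<longlonglongrightarrow> y \<bullet> l)"

text \<open>A string is a list of indices, possibly with repetitions (so that a uniform bound on the lengths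
  is a genuine assumption); \<open>fold\<close> applies the projection of the head first.\<close>

definition string_proj ::
    "(nat \<Rightarrow> 'a::{real_inner,complete_space} set) \<Rightarrow> nat list \<Rightarrow> 'a \<Rightarrow> 'a" where
  "string_proj C J = fold (\<lambda>j. metric_proj (C j)) J"

definition string_average ::
    "(nat \<Rightarrow> 'a::{real_inner,complete_space} set) \<Rightarrow> nat \<Rightarrow> (nat \<Rightarrow> nat list) \<Rightarrow> (nat \<Rightarrow> real)
      \<Rightarrow> 'a \<Rightarrow> 'a" where
  "string_average C N J w x = (\<Sum>n=1..N. w n *\<^sub>R string_proj C (J n) x)"

text \<open>\<open>T k \<circ> \<dots> \<circ> T i\<close> for \<open>i \<le> k\<close>, with \<open>T i\<close> applied first (the identity for \<open>k < i\<close>).\<close>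

definition iterate_ops :: "(nat \<Rightarrow> 'a \<Rightarrow> 'a) \<Rightarrow> nat \<Rightarrow> nat \<Rightarrow> 'a \<Rightarrow> 'a" where
  "iterate_ops T k i = fold T [i..<Suc k]"

definition max_dist :: "'i set \<Rightarrow> ('i \<Rightarrow> 'a::metric_space set) \<Rightarrow> 'a \<Rightarrow> real" where
  "max_dist I C x = (MAX i\<in>I. infdist x (C i))"

definition regular_over ::
    "'i set \<Rightarrow> ('i \<Rightarrow> 'a::metric_space set) \<Rightarrow> 'a set \<Rightarrow> bool" where
  "regular_over I C S \<longleftrightarrow>
    (\<forall>y :: nat \<Rightarrow> 'a. (\<forall>k. y k \<in> S) \<longrightarrow> (\<lambda>k. max_dist I C (y k)) \<longlonglongrightarrow> 0
      \<longrightarrow> (\<lambda>k. infdist (y k) (\<Inter>i\<in>I. C i)) \<longlonglongrightarrow> 0)"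

definition linearly_regular_over ::
    "'i set \<Rightarrow> ('i \<Rightarrow> 'a::metric_space set) \<Rightarrow> real \<Rightarrow> 'a set \<Rightarrow> bool" where
  "linearly_regular_over I C \<kappa> S \<longleftrightarrow>
    \<kappa> > 0 \<and> (\<forall>x\<in>S. infdist x (\<Inter>i\<in>I. C i) \<le> \<kappa> * max_dist I C x)"

definition boundedly_regular :: "'i set \<Rightarrow> ('i \<Rightarrow> 'a::metric_space set) \<Rightarrow> bool" where
  "boundedly_regular I C \<longleftrightarrow> (\<forall>S. bounded S \<longrightarrow> regular_over I C S)"

definition boundedly_linearly_regular :: "'i set \<Rightarrow> ('i \<Rightarrow> 'a::metric_space set) \<Rightarrow> bool" where
  "boundedly_linearly_regular I C \<longleftrightarrow>
    (\<forall>S. bounded S \<longrightarrow> (\<exists>\<kappa>. linearly_regular_over I C \<kappa> S))"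

end

theory Submission
  imports Defs
begin

text \<open>Projections onto the sets of a string decrease the squared distance to a common point \<open>z\<close> by at
  least the sum of the squared lengths of the single projection steps. After averaging, with weights
  at least \<open>\<omega>\<close> and strings of length at most \<open>m\<close>, the decrease of \<open>norm (_ - z)\<^sup>2\<close> under \<open>T k\<close>,
  multiplied by \<open>m / \<omega>\<close>, bounds the squared length of the step and the squared distances to all sets
  used at time \<open>k\<close> (\<open>string_average_displacement\<close>, \<open>string_average_proximity\<close>). So an exact orbit is
  Fejer monotone with respect to the intersection of the sets and, as every index occurs within each
  window of \<open>s\<close> steps, its distance to each set tends to zero (\<open>orbit_infdist_tendsto_0\<close>).

  Such a sequence \<open>u\<close> converges weakly (\<open>fejer_weakly_converges\<close>). Its projections onto the
  intersection converge in norm to a point \<open>p\<close>, and if \<open>u\<close> did not converge weakly to \<open>p\<close>, the closed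
  convex hulls of the tails of some subsequence would have a common point \<open>q \<noteq> p\<close> in the intersection,
  against the variational inequality for the projections. This needs only that a decreasing sequence
  of nonempty bounded closed convex sets has a common point
  (\<open>decseq_closed_convex_bounded_Inter\<close>), not weak sequential compactness of balls. In addition,
  \<open>norm (u k - p)\<close> is at most twice the distance of \<open>u k\<close> to the intersection. So bounded regularity
  gives norm convergence, and bounded linear regularity gives a geometric rate, since the squared
  distance to the intersection is then at most a multiple of its decrease over \<open>s\<close> steps
  (\<open>orbit_linear_rate\<close>).

  The superiorized sequence is an inexact orbit: by nonexpansiveness of \<open>T k\<close> its \<open>k\<close>-th step deviates
  from \<open>T k\<close> by at most \<open>\<beta> k * norm (v k)\<close>, which is summable. From time \<open>i\<close> on it therefore stays
  within the tail sum at \<open>i\<close> of the exact orbit started at \<open>x i\<close>, and the limits of these exact orbits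
  converge to \<open>xinf\<close> with distance at most the same tail sum. The two contributions account for the
  factor \<open>2\<close> in the first two error bounds.\<close>

section \<open>Metric projections in Hilbert space\<close>

lemma Cauchy_dist_sq_le:
  fixes f :: "nat \<Rightarrow> 'a::metric_space" and a :: "nat \<Rightarrow> real"
  assumes le: "\<And>m n. m \<le> n \<Longrightarrow> (dist (f m) (f n))\<^sup>2 \<le> a m"
    and a: "a \<longlonglongrightarrow> 0"
  shows "Cauchy f"
proof (rule metric_CauchyI)
  fix e :: real assume "e > 0"
  then have "\<forall>\<^sub>F n in sequentially. a n < e\<^sup>2"
    using a by (intro order_tendstoD(2)) auto
  then obtain K where K: "\<And>n. n \<ge> K \<Longrightarrow> a n < e\<^sup>2"
    unfolding eventually_sequentially by blast
  have *: "dist (f m) (f n) < e" if "K \<le> m" "m \<le> n" for m n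
  proof (rule power_less_imp_less_base)
    show "(dist (f m) (f n))\<^sup>2 < e\<^sup>2"
      using le[OF that(2)] K[OF that(1)] by linarith
  qed (use \<open>e > 0\<close> in auto)
  have "dist (f m) (f n) < e" if "K \<le> m" "K \<le> n" for m n
    using *[of m n] *[of n m] that by (metis dist_commute nle_le)
  then show "\<exists>M. \<forall>m\<ge>M. \<forall>n\<ge>M. dist (f m) (f n) < e"
    by blast
qed

lemma parallelogram_midpoint:
  fixes x y :: "'a::real_inner"
  shows "(dist x y)\<^sup>2 = 2 * (norm x)\<^sup>2 + 2 * (norm y)\<^sup>2 - 4 * (norm ((1/2) *\<^sub>R x + (1/2) *\<^sub>R y))\<^sup>2"
  by (simp add: dist_norm power2_norm_eq_inner inner_diff inner_add inner_commute algebra_simps)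

text \<open>This substitutes for the weak compactness of bounded closed convex sets. Points of almost
  minimal norm in the sets \<open>K n\<close> form a Cauchy sequence by the parallelogram identity, and their
  limit is a common point.\<close>

lemma decseq_closed_convex_bounded_Inter:
  fixes K :: "nat \<Rightarrow> 'a::{real_inner,complete_space} set"
  assumes dec: "decseq K" and closed: "\<And>n. closed (K n)" and conv: "\<And>n. convex (K n)"
    and ne: "\<And>n. K n \<noteq> {}" and bdd: "bounded (K 0)"
  obtains p where "\<And>n. p \<in> K n"
proof -
  define d where "d n = infdist 0 (K n)" for n
  define \<epsilon> where "\<epsilon> n = inverse (real (Suc n))" for n
  have \<epsilon>: "0 < \<epsilon> n" "\<epsilon> n \<le> 1" for n
    by (auto simp: \<epsilon>_def field_simps)
  have \<epsilon>_mono: "\<epsilon> n \<le> \<epsilon> m" if "m \<le> n" for m n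
    using that by (simp add: \<epsilon>_def field_simps)
  have \<epsilon>_lim: "\<epsilon> \<longlonglongrightarrow> 0"
    unfolding \<epsilon>_def by (rule LIMSEQ_inverse_real_of_nat)
  obtain R where R: "\<And>x. x \<in> K 0 \<Longrightarrow> norm x \<le> R"
    using bdd unfolding bounded_iff by blast
  have sub: "K n \<subseteq> K m" if "m \<le> n" for m n
    using dec that unfolding decseq_def by blast
  have d_le: "d n \<le> norm x" if "x \<in> K n" for n x
    using infdist_le[OF that, of 0] by (simp add: d_def)
  have d0: "d n \<ge> 0" for n
    by (simp add: d_def infdist_nonneg)
  have d_mono: "d m \<le> d n" if "m \<le> n" for m n
    unfolding d_def using infdist_mono[OF sub[OF that] ne] .
  have d_R: "d n \<le> R" for n
  proof -
    obtain x where "x \<in> K n" using ne by blast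
    then show ?thesis using d_le[of x n] R[of x] sub[of 0 n] by fastforce
  qed
  have "incseq d"
    using d_mono by (simp add: incseq_def)
  then obtain L where L: "d \<longlonglongrightarrow> L" "\<And>n. d n \<le> L"
    using incseq_convergent[of d R] d_R by blast
  have "\<exists>x. x \<in> K n \<and> norm x < d n + \<epsilon> n" for n
  proof -
    have "Inf (dist 0 ` K n) < d n + \<epsilon> n"
      using \<epsilon>(1)[of n] by (simp add: d_def infdist_notempty[OF ne])
    then have "\<exists>y\<in>dist 0 ` K n. y < d n + \<epsilon> n"
      by (rule cInf_lessD[rotated]) (use ne in auto)
    then show ?thesis by auto
  qed
  then obtain p where p: "\<And>n. p n \<in> K n" "\<And>n. norm (p n) < d n + \<epsilon> n"
    by metis
  have p2: "(norm (p n))\<^sup>2 \<le> (d n)\<^sup>2 + (2 * R + 1) * \<epsilon> n" for n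
  proof -
    have "(norm (p n))\<^sup>2 \<le> (d n + \<epsilon> n)\<^sup>2"
      using p(2)[of n] by (intro power_mono) auto
    also have "\<dots> = (d n)\<^sup>2 + (2 * d n + \<epsilon> n) * \<epsilon> n"
      by (simp add: power2_eq_square algebra_simps)
    also have "\<dots> \<le> (d n)\<^sup>2 + (2 * R + 1) * \<epsilon> n"
      using d_R[of n] \<epsilon>[of n] by (intro add_left_mono mult_right_mono) auto
    finally show ?thesis .
  qed
  have R0: "0 \<le> R" using d0 d_R order_trans by blast
  have "Cauchy p"
  proof (rule Cauchy_dist_sq_le)
    fix m n :: nat assume mn: "m \<le> n"
    have "(1/2) *\<^sub>R p m + (1/2) *\<^sub>R p n \<in> K m"
      using p(1) sub[OF mn] by (intro convexD[OF conv]) auto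
    then have "(d m)\<^sup>2 \<le> (norm ((1/2) *\<^sub>R p m + (1/2) *\<^sub>R p n))\<^sup>2"
      by (intro power_mono d_le d0)
    moreover have "(d n)\<^sup>2 \<le> L\<^sup>2"
      by (intro power_mono L d0)
    moreover have "(2 * R + 1) * \<epsilon> n \<le> (2 * R + 1) * \<epsilon> m"
      using \<epsilon>_mono[OF mn] R0 by (intro mult_left_mono) auto
    ultimately show "(dist (p m) (p n))\<^sup>2 \<le> 2 * (L\<^sup>2 - (d m)\<^sup>2) + 4 * ((2 * R + 1) * \<epsilon> m)"
      using p2[of m] p2[of n] parallelogram_midpoint[of "p m" "p n"] by argo
  next
    have "(\<lambda>m. 2 * (L\<^sup>2 - (d m)\<^sup>2) + 4 * ((2 * R + 1) * \<epsilon> m)) \<longlonglongrightarrow>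
        2 * (L\<^sup>2 - L\<^sup>2) + 4 * ((2 * R + 1) * 0)"
      by (intro tendsto_intros L \<epsilon>_lim)
    then show "(\<lambda>m. 2 * (L\<^sup>2 - (d m)\<^sup>2) + 4 * ((2 * R + 1) * \<epsilon> m)) \<longlonglongrightarrow> 0"
      by simp
  qed
  then obtain q where q: "p \<longlonglongrightarrow> q"
    using Cauchy_convergent_iff convergent_def by blast
  have "q \<in> K n" for n
  proof (rule Lim_in_closed_set[OF closed _ _ q])
    show "\<forall>\<^sub>F k in sequentially. p k \<in> K n"
      using p(1) sub unfolding eventually_sequentially by blast
  qed auto
  then show ?thesis using that by blast
qed

text \<open>The nearest point is a common point of the sets \<open>D \<inter> cball x (infdist x D + 1 / (n + 1))\<close>.\<close>

lemma nearest_point_exists: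
  fixes D :: "'a::{real_inner,complete_space} set"
  assumes "closed D" "convex D" "D \<noteq> {}"
  shows "\<exists>p\<in>D. \<forall>z\<in>D. dist x p \<le> dist x z"
proof -
  define K where "K n = D \<inter> cball x (infdist x D + inverse (real (Suc n)))" for n
  have "\<exists>p. \<forall>n. p \<in> K n"
  proof (rule decseq_closed_convex_bounded_Inter[of K])
    show "decseq K"
      unfolding decseq_def K_def by (intro allI impI Int_mono subset_cball) (auto simp: field_simps)
    show "K n \<noteq> {}" for n
    proof -
      have "Inf (dist x ` D) < infdist x D + inverse (real (Suc n))"
        by (simp add: infdist_notempty[OF assms(3)])
      then have "\<exists>y\<in>dist x ` D. y < infdist x D + inverse (real (Suc n))"
        by (rule cInf_lessD[rotated]) (use assms in auto)
      then show ?thesis unfolding K_def by force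
    qed
  qed (use assms in \<open>auto simp: K_def closed_Int convex_Int bounded_Int\<close>)
  then obtain p where p: "\<And>n. p \<in> K n" by blast
  have "dist x p \<le> infdist x D"
  proof (rule LIMSEQ_le_const[where X = "\<lambda>n. infdist x D + inverse (real (Suc n))"])
    show "(\<lambda>n. infdist x D + inverse (real (Suc n))) \<longlonglongrightarrow> infdist x D"
      by (rule LIMSEQ_inverse_real_of_nat_add)
  qed (use p in \<open>auto simp: K_def\<close>)
  then show ?thesis
    using p[of 0] infdist_le unfolding K_def by (meson IntD1 order_trans)
qed

lemma metric_proj_nearest:
  fixes D :: "'a::{real_inner,complete_space} set"
  assumes "closed D" "convex D" "D \<noteq> {}"
  shows "metric_proj D x \<in> D \<and> (\<forall>z\<in>D. dist x (metric_proj D x) \<le> dist x z)"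
  unfolding metric_proj_def
proof (rule theI')
  show "\<exists>!p. p \<in> D \<and> (\<forall>z\<in>D. dist x p \<le> dist x z)"
    using nearest_point_exists[OF assms, of x] any_closest_point_unique[OF assms(2,1)] by metis
qed

lemma metric_proj_inner_le:
  fixes D :: "'a::{real_inner,complete_space} set"
  assumes "closed D" "convex D" "z \<in> D"
  shows "(x - metric_proj D x) \<bullet> (z - metric_proj D x) \<le> 0"
  using metric_proj_nearest[OF assms(1,2), of x] assms any_closest_point_dot[OF assms(2,1)] by blast

lemma metric_proj_in:
  fixes D :: "'a::{real_inner,complete_space} set"
  assumes "closed D" "convex D" "D \<noteq> {}"
  shows "metric_proj D x \<in> D"
  using metric_proj_nearest[OF assms] by blast

lemma infdist_eq_dist_metric_proj:
  fixes D :: "'a::{real_inner,complete_space} set"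
  assumes "closed D" "convex D" "D \<noteq> {}"
  shows "infdist x D = dist x (metric_proj D x)"
proof (rule antisym)
  show "infdist x D \<le> dist x (metric_proj D x)"
    using metric_proj_in[OF assms] by (rule infdist_le)
  show "dist x (metric_proj D x) \<le> infdist x D"
    unfolding infdist_notempty[OF assms(3)]
    using metric_proj_nearest[OF assms, of x] assms(3) by (intro cINF_greatest) auto
qed

lemma metric_proj_Pythagoras:
  fixes D :: "'a::{real_inner,complete_space} set"
  assumes "closed D" "convex D" "z \<in> D"
  shows "(norm (metric_proj D x - z))\<^sup>2 + (norm (x - metric_proj D x))\<^sup>2 \<le> (norm (x - z))\<^sup>2"
  using metric_proj_inner_le[OF assms, of x]
  by (simp add: power2_norm_eq_inner inner_diff inner_commute)

lemma metric_proj_nonexpansive: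
  fixes D :: "'a::{real_inner,complete_space} set"
  assumes "closed D" "convex D" "D \<noteq> {}"
  shows "norm (metric_proj D x - metric_proj D y) \<le> norm (x - y)"
proof -
  let ?p = "metric_proj D x" and ?q = "metric_proj D y"
  have "(x - ?p) \<bullet> (?q - ?p) \<le> 0" "(y - ?q) \<bullet> (?p - ?q) \<le> 0"
    using metric_proj_inner_le[OF assms(1,2)] metric_proj_in[OF assms] by blast+
  then have "(norm (?p - ?q))\<^sup>2 \<le> (x - y) \<bullet> (?p - ?q)"
    by (simp add: power2_norm_eq_inner inner_diff inner_commute)
  also have "\<dots> \<le> norm (x - y) * norm (?p - ?q)"
    by (rule norm_cauchy_schwarz)
  finally show ?thesis
    by (cases "?p = ?q") (simp_all add: power2_eq_square mult_le_cancel_right)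
qed

lemma convex_infdist_le:
  fixes D :: "'a::{real_inner,complete_space} set"
  assumes "closed D" "convex D" "D \<noteq> {}"
  shows "convex {x. infdist x D \<le> r}"
proof (rule convexI)
  fix x y :: 'a and u v :: real
  assume *: "x \<in> {x. infdist x D \<le> r}" "y \<in> {x. infdist x D \<le> r}" "0 \<le> u" "0 \<le> v" "u + v = 1"
  let ?p = "metric_proj D x" and ?q = "metric_proj D y"
  have "u *\<^sub>R ?p + v *\<^sub>R ?q \<in> D"
    using * metric_proj_in[OF assms] by (intro convexD[OF assms(2)]) auto
  then have "infdist (u *\<^sub>R x + v *\<^sub>R y) D \<le> dist (u *\<^sub>R x + v *\<^sub>R y) (u *\<^sub>R ?p + v *\<^sub>R ?q)"
    by (rule infdist_le)
  also have "\<dots> = norm (u *\<^sub>R (x - ?p) + v *\<^sub>R (y - ?q))"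
    by (simp add: dist_norm algebra_simps)
  also have "\<dots> \<le> u * norm (x - ?p) + v * norm (y - ?q)"
    by (rule order_trans[OF norm_triangle_ineq]) (use * in simp)
  also have "\<dots> \<le> r"
    using * by (intro convex_bound_le) (auto simp: infdist_eq_dist_metric_proj[OF assms] dist_norm)
  finally show "u *\<^sub>R x + v *\<^sub>R y \<in> {x. infdist x D \<le> r}" by simp
qed

section \<open>Fejer monotone sequences\<close>

lemma weakly_converges_norm_le:
  assumes "weakly_converges a l" and "\<forall>\<^sub>F k in sequentially. norm (a k) \<le> r"
  shows "norm l \<le> r"
proof -
  have "l \<bullet> l \<le> norm l * r"
  proof (rule tendsto_upperbound)
    show "(\<lambda>k. l \<bullet> a k) \<longlonglongrightarrow> l \<bullet> l"
      using assms(1) unfolding weakly_converges_def by blast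
    show "\<forall>\<^sub>F k in sequentially. l \<bullet> a k \<le> norm l * r"
      using assms(2)
    proof eventually_elim
      case (elim k)
      then show ?case
        using norm_cauchy_schwarz[of l "a k"] by (meson mult_left_mono norm_ge_zero order_trans)
    qed
  qed simp
  moreover have "0 \<le> r"
    using assms(2) by (metis (mono_tags, lifting) eventually_happens norm_ge_zero order_trans
        sequentially_bot)
  ultimately show ?thesis
    by (cases "l = 0") (simp_all add: dot_square_norm power2_eq_square)
qed

lemma weakly_converges_diff:
  assumes "weakly_converges a l" "weakly_converges b m"
  shows "weakly_converges (\<lambda>k. a k - b k) (l - m)"
  using assms unfolding weakly_converges_def by (auto simp: inner_diff_right intro!: tendsto_diff)

text \<open>Here and below, \<open>u\<close> is Fejer monotone: no step increases the distance to any point of \<open>Z\<close>.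
  The limit \<open>p\<close> of the projections is later identified as the weak limit of \<open>u\<close> itself. The last
  bound holds since the projection of \<open>u k\<close> onto \<open>Z\<close> lies within \<open>infdist (u k) Z\<close> of both \<open>u k\<close>
  and \<open>p\<close>.\<close>

lemma fejer_metric_proj_convergent:
  fixes u :: "nat \<Rightarrow> 'a::{real_inner,complete_space}"
  assumes Z: "closed Z" "convex Z" "Z \<noteq> {}"
    and fejer: "\<And>z k. z \<in> Z \<Longrightarrow> norm (u (Suc k) - z) \<le> norm (u k - z)"
  obtains p where "p \<in> Z" "(\<lambda>k. metric_proj Z (u k)) \<longlonglongrightarrow> p"
    "\<And>k. norm (u k - p) \<le> 2 * infdist (u k) Z"
proof -
  define P where "P k = metric_proj Z (u k)" for k
  define d where "d k = infdist (u k) Z" for k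
  have P: "P k \<in> Z" for k
    unfolding P_def by (rule metric_proj_in[OF Z])
  have d: "d k = norm (u k - P k)" for k
    by (simp add: d_def P_def infdist_eq_dist_metric_proj[OF Z] dist_norm)
  have mono: "norm (u n - z) \<le> norm (u m - z)" if "z \<in> Z" "m \<le> n" for m n z
    using lift_Suc_antimono_le[of "\<lambda>k. norm (u k - z)"] fejer[OF that(1)] that(2) by blast
  have pyth: "(norm (P n - z))\<^sup>2 + (d n)\<^sup>2 \<le> (norm (u m - z))\<^sup>2" if "z \<in> Z" "m \<le> n" for m n z
  proof -
    have "(norm (P n - z))\<^sup>2 + (d n)\<^sup>2 \<le> (norm (u n - z))\<^sup>2"
      using metric_proj_Pythagoras[OF Z(1,2) that(1), of "u n"] by (simp add: d P_def)
    also have "\<dots> \<le> (norm (u m - z))\<^sup>2"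
      using mono[OF that] by (intro power_mono) auto
    finally show ?thesis .
  qed
  have step: "(norm (P n - P m))\<^sup>2 + (d n)\<^sup>2 \<le> (d m)\<^sup>2" if "m \<le> n" for m n
    using pyth[OF P that, of m] by (simp add: d)
  have "decseq (\<lambda>n. (d n)\<^sup>2)"
    unfolding decseq_def using step by (smt (verit) zero_le_power2)
  then obtain L where L: "(\<lambda>n. (d n)\<^sup>2) \<longlonglongrightarrow> L" "\<And>n. L \<le> (d n)\<^sup>2"
    using decseq_convergent[of "\<lambda>n. (d n)\<^sup>2" 0] by auto
  have "Cauchy P"
  proof (rule Cauchy_dist_sq_le)
    show "(dist (P m) (P n))\<^sup>2 \<le> (d m)\<^sup>2 - L" if "m \<le> n" for m n
      using step[OF that] L(2)[of n] by (simp add: dist_norm norm_minus_commute)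
    show "(\<lambda>m. (d m)\<^sup>2 - L) \<longlonglongrightarrow> 0"
      using tendsto_diff[OF L(1) tendsto_const, of L] by simp
  qed
  then obtain p where p: "P \<longlonglongrightarrow> p"
    using Cauchy_convergent_iff convergent_def by blast
  have "p \<in> Z"
    using closed_sequentially[OF Z(1) _ p] P by blast
  moreover have "norm (u m - p) \<le> 2 * infdist (u m) Z" for m
  proof -
    have "norm (p - P m) \<le> d m"
    proof (rule tendsto_upperbound)
      show "(\<lambda>n. norm (P n - P m)) \<longlonglongrightarrow> norm (p - P m)"
        by (intro tendsto_intros p)
      show "\<forall>\<^sub>F n in sequentially. norm (P n - P m) \<le> d m"
        unfolding eventually_sequentially
      proof (intro exI allI impI)
        fix n assume "m \<le> n"
        then have "(norm (P n - P m))\<^sup>2 \<le> (d m)\<^sup>2"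
          using step[of m n] by (smt (verit) zero_le_power2)
        then show "norm (P n - P m) \<le> d m"
          by (rule power2_le_imp_le) (simp add: d)
      qed
    qed simp
    then show ?thesis
      using norm_triangle_ineq4[of "u m - P m" "p - P m"] d[of m] by (simp add: d_def)
  qed
  ultimately show ?thesis
    using that[of p] p unfolding P_def by blast
qed

text \<open>If \<open>y \<bullet> u k\<close> stays above \<open>y \<bullet> p + e\<close> along a subsequence, then the closed convex hulls of
  the tails of that subsequence have a common point \<open>q\<close>. It lies in every \<open>C i\<close>, hence in the
  intersection, and the variational inequalities for the projections of \<open>u k\<close> force \<open>q = p\<close>.\<close>

lemma fejer_weakly_converges:
  fixes u :: "nat \<Rightarrow> 'a::{real_inner,complete_space}"
  assumes C: "\<And>i. i \<in> I \<Longrightarrow> closed (C i)" "\<And>i. i \<in> I \<Longrightarrow> convex (C i)" "(\<Inter>i\<in>I. C i) \<noteq> {}"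
    and fejer: "\<And>z k. z \<in> (\<Inter>i\<in>I. C i) \<Longrightarrow> norm (u (Suc k) - z) \<le> norm (u k - z)"
    and dist0: "\<And>i. i \<in> I \<Longrightarrow> (\<lambda>k. infdist (u k) (C i)) \<longlonglongrightarrow> 0"
  obtains p where "p \<in> (\<Inter>i\<in>I. C i)" "weakly_converges u p"
    "\<And>k. norm (u k - p) \<le> 2 * infdist (u k) (\<Inter>i\<in>I. C i)"
proof -
  define Z where "Z = (\<Inter>i\<in>I. C i)"
  define P where "P k = metric_proj Z (u k)" for k
  have Z: "closed Z" "convex Z" "Z \<noteq> {}"
    unfolding Z_def using C by (auto intro!: closed_INT convex_INT)
  obtain p where p: "p \<in> Z" "P \<longlonglongrightarrow> p" "\<And>k. norm (u k - p) \<le> 2 * infdist (u k) Z"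
    using fejer_metric_proj_convergent[OF Z, of u] fejer unfolding Z_def P_def by blast
  have mono: "norm (u n - z) \<le> norm (u 0 - z)" if "z \<in> Z" for n z
    using lift_Suc_antimono_le[of "\<lambda>k. norm (u k - z)" 0 n] fejer that unfolding Z_def by blast
  have dP: "norm (u k - P k) \<le> norm (u 0 - p)" for k
    using mono[OF p(1), of k] infdist_le[OF p(1), of "u k"]
    by (simp add: P_def infdist_eq_dist_metric_proj[OF Z] dist_norm)
  have upper: "\<forall>\<^sub>F k in sequentially. y \<bullet> u k < y \<bullet> p + e" if "e > 0" for y e
  proof (rule ccontr)
    assume neg: "\<not> ?thesis"
    define B where "B = {k. y \<bullet> p + e \<le> y \<bullet> u k}"
    have B: "\<exists>k\<in>B. k \<ge> n" for n
      using neg unfolding eventually_sequentially B_def by (force simp: not_less)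
    define K where "K n = closure (convex hull (u ` {k\<in>B. n \<le> k}))" for n
    have sub: "K n \<subseteq> A" if "closed A" "convex A" "\<And>k. k \<in> B \<Longrightarrow> n \<le> k \<Longrightarrow> u k \<in> A" for A n
      unfolding K_def using that by (intro closure_minimal hull_minimal) auto
    obtain q where q: "\<And>n. q \<in> K n"
    proof (rule decseq_closed_convex_bounded_Inter[of K])
      show "decseq K"
        unfolding decseq_def K_def by (intro allI impI closure_mono hull_mono) auto
      show "K n \<noteq> {}" for n
        using B[of n] by (auto simp: K_def)
      have "K 0 \<subseteq> cball p (norm (u 0 - p))"
        using mono[OF p(1)] by (intro sub) (auto simp: dist_norm norm_minus_commute)
      then show "bounded (K 0)"
        using bounded_cball bounded_subset by blast
    qed (auto simp: K_def)
    have q_mem: "q \<in> A" if "closed A" "convex A" "\<forall>\<^sub>F k in sequentially. u k \<in> A" for A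
      using that(3) sub[OF that(1,2)] q unfolding eventually_sequentially by (metis subsetD)
    have "q \<in> C i" if i: "i \<in> I" for i
    proof -
      have ne: "C i \<noteq> {}" using C(3) i by blast
      have "infdist q (C i) \<le> 0 + r" if "r > 0" for r
      proof -
        have "q \<in> {a. infdist a (C i) \<le> r}"
        proof (rule q_mem)
          show "closed {a. infdist a (C i) \<le> r}"
            by (intro closed_Collect_le continuous_intros)
          show "convex {a. infdist a (C i) \<le> r}"
            by (rule convex_infdist_le) (use C i ne in auto)
          show "\<forall>\<^sub>F k in sequentially. u k \<in> {a. infdist a (C i) \<le> r}"
            using order_tendstoD(2)[OF dist0[OF i] that] by (auto elim: eventually_mono)
        qed
        then show ?thesis by simp
      qed
      then have "infdist q (C i) = 0"
        using field_le_epsilon infdist_nonneg by (metis antisym)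
      then show ?thesis
        using in_closed_iff_infdist_zero[OF C(1)[OF i] ne] by blast
    qed
    then have "q \<in> Z" by (simp add: Z_def)
    have "(q - p) \<bullet> (q - p) \<le> 0 + r" if "r > 0" for r
    proof -
      have lim: "(\<lambda>k. norm (P k - p) * (norm (u 0 - p) + norm (q - p))) \<longlonglongrightarrow>
          norm (p - p) * (norm (u 0 - p) + norm (q - p))"
        by (intro tendsto_intros p)
      have "q \<in> {a. (q - p) \<bullet> a \<le> (q - p) \<bullet> p + r}"
      proof (rule q_mem)
        have "\<forall>\<^sub>F k in sequentially. norm (P k - p) * (norm (u 0 - p) + norm (q - p)) < r"
          using that by (intro order_tendstoD(2)[OF lim]) simp
        then show "\<forall>\<^sub>F k in sequentially. u k \<in> {a. (q - p) \<bullet> a \<le> (q - p) \<bullet> p + r}"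
        proof eventually_elim
          case (elim k)
          have "(u k - P k) \<bullet> (q - P k) \<le> 0"
            unfolding P_def using metric_proj_inner_le[OF Z(1,2) \<open>q \<in> Z\<close>] .
          moreover have "(u k - p) \<bullet> (q - p) = (u k - P k) \<bullet> (q - P k)
              + ((u k - P k) \<bullet> (P k - p) + (P k - p) \<bullet> (q - p))"
            by (simp add: inner_diff inner_commute)
          moreover have "(u k - P k) \<bullet> (P k - p) \<le> norm (u 0 - p) * norm (P k - p)"
            using norm_cauchy_schwarz[of "u k - P k" "P k - p"] dP[of k]
            by (meson mult_right_mono norm_ge_zero order_trans)
          moreover have "(P k - p) \<bullet> (q - p) \<le> norm (P k - p) * norm (q - p)"
            by (rule norm_cauchy_schwarz)
          ultimately have "(u k - p) \<bullet> (q - p) \<le> r"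
            using elim by (simp add: algebra_simps)
          then show ?case
            by (simp add: inner_diff inner_commute)
        qed
      qed (auto simp: closed_halfspace_le convex_halfspace_le)
      then show ?thesis by (simp add: inner_diff)
    qed
    then have "(q - p) \<bullet> (q - p) \<le> 0"
      using field_le_epsilon by blast
    then have "q = p"
      by (metis antisym eq_iff_diff_eq_0 inner_eq_zero_iff inner_ge_zero)
    have "q \<in> {a. y \<bullet> a \<ge> y \<bullet> p + e}"
      using q[of 0] by (rule subsetD[OF sub, rotated -1])
        (auto simp: closed_halfspace_ge convex_halfspace_ge B_def)
    then show False
      using \<open>q = p\<close> \<open>e > 0\<close> by simp
  qed
  have "weakly_converges u p"
    unfolding weakly_converges_def
  proof (intro allI tendstoI)
    fix y and e :: real assume "e > 0"
    show "\<forall>\<^sub>F k in sequentially. dist (y \<bullet> u k) (y \<bullet> p) < e"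
      using upper[OF \<open>e > 0\<close>, of y] upper[OF \<open>e > 0\<close>, of "- y"]
      by eventually_elim (auto simp: dist_real_def)
  qed
  then show ?thesis
    using that[of p] p unfolding Z_def by blast
qed

section \<open>Products of operators under an intermittent control\<close>

text \<open>The unperturbed trajectory from \<open>a\<close> started at time \<open>i\<close>: \<open>orbit T i a n\<close> is its position after
  the \<open>n\<close> operators \<open>T i, \<dots>, T (i + n - 1)\<close>. Counting steps from \<open>0\<close> puts it one index behind
  \<open>iterate_ops\<close>, whose product includes both end points.\<close>

definition orbit :: "(nat \<Rightarrow> 'a \<Rightarrow> 'a) \<Rightarrow> nat \<Rightarrow> 'a \<Rightarrow> nat \<Rightarrow> 'a" where
  "orbit T i a n = fold T [i..<i + n] a"

lemma orbit_0 [simp]: "orbit T i a 0 = a"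
  by (simp add: orbit_def)

lemma orbit_Suc [simp]: "orbit T i a (Suc n) = T (i + n) (orbit T i a n)"
  by (simp add: orbit_def)

lemma orbit_Suc_shift: "orbit T i a (Suc n) = orbit T (Suc i) (T i a) n"
  by (induction n) auto

lemma iterate_ops_eq_orbit: "iterate_ops T (i + n) i a = orbit T i a (Suc n)"
  unfolding iterate_ops_def orbit_def by simp

lemma tendsto_iterate_ops:
  assumes "(\<lambda>n. f (orbit T i a n)) \<longlonglongrightarrow> l"
  shows "(\<lambda>k. f (iterate_ops T k i a)) \<longlonglongrightarrow> l"
proof (rule LIMSEQ_offset[where k = i])
  have "iterate_ops T (n + i) i a = orbit T i a (Suc n)" for n
    by (metis add.commute iterate_ops_eq_orbit)
  then show "(\<lambda>n. f (iterate_ops T (n + i) i a)) \<longlonglongrightarrow> l"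
    using LIMSEQ_Suc[OF assms] by simp
qed

text \<open>A weighted Cauchy-Schwarz inequality for chains of steps: if \<open>b\<close> bounds a distance covered in \<open>r\<close>
  steps, with \<open>e\<close> bounding the sum of their squared lengths, then one more step of length \<open>a\<close> adds
  \<open>1\<close> to \<open>r\<close> and \<open>a\<^sup>2\<close> to \<open>e\<close>.\<close>

lemma square_add_le:
  fixes a b e r :: real
  assumes "b\<^sup>2 \<le> r * e" "0 \<le> r" "0 \<le> e"
  shows "(a + b)\<^sup>2 \<le> (r + 1) * (a\<^sup>2 + e)"
proof (cases "r = 0")
  case True
  then show ?thesis using assms by simp
next
  case False
  then have "r > 0" using assms by simp
  have "0 \<le> (r * a - b)\<^sup>2" by simp
  also have "\<dots> = r * (r * a\<^sup>2 - 2 * a * b) + b\<^sup>2"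
    by (simp add: power2_eq_square algebra_simps)
  also have "\<dots> \<le> r * (r * a\<^sup>2 - 2 * a * b + e)"
    using assms(1) by (simp add: algebra_simps)
  finally have "0 \<le> r * a\<^sup>2 - 2 * a * b + e"
    using \<open>r > 0\<close> by (simp add: zero_le_mult_iff)
  then show ?thesis
    using assms(1) by (simp add: power2_eq_square algebra_simps)
qed

context
  fixes C :: "'i \<Rightarrow> 'a::metric_space set" and I :: "'i set"
  assumes fin: "finite I" and ne: "I \<noteq> {}"
begin

lemma max_dist_attained: "\<exists>j\<in>I. max_dist I C a = infdist a (C j)"
proof -
  have "max_dist I C a \<in> (\<lambda>j. infdist a (C j)) ` I"
    unfolding max_dist_def using fin ne by (intro Max_in) auto
  then show ?thesis by auto
qed

lemma max_dist_nonneg: "0 \<le> max_dist I C a"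
  using max_dist_attained[of a] infdist_nonneg by metis

lemma max_dist_le_infdist_Inter:
  "(\<Inter>i\<in>I. C i) \<noteq> {} \<Longrightarrow> max_dist I C a \<le> infdist a (\<Inter>i\<in>I. C i)"
  using max_dist_attained[of a] infdist_mono[of "\<Inter>i\<in>I. C i"] by (metis INT_lower)

lemma max_dist_tendsto_0:
  assumes "\<And>j. j \<in> I \<Longrightarrow> (\<lambda>k. infdist (u k) (C j)) \<longlonglongrightarrow> 0"
  shows "(\<lambda>k. max_dist I C (u k)) \<longlonglongrightarrow> 0"
proof (rule tendsto_sandwich[OF _ _ tendsto_const])
  show "(\<lambda>k. \<Sum>j\<in>I. infdist (u k) (C j)) \<longlonglongrightarrow> 0"
    by (rule tendsto_null_sum) (use assms in auto)
  have "max_dist I C (u k) \<le> (\<Sum>j\<in>I. infdist (u k) (C j))" for k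
  proof -
    obtain j where "j \<in> I" "max_dist I C (u k) = infdist (u k) (C j)"
      using max_dist_attained[of "u k"] by blast
    then show ?thesis
      using member_le_sum[of j I "\<lambda>j. infdist (u k) (C j)"] fin by (simp add: infdist_nonneg)
  qed
  then show "\<forall>\<^sub>F k in sequentially. max_dist I C (u k) \<le> (\<Sum>j\<in>I. infdist (u k) (C j))"
    by simp
qed (simp add: max_dist_nonneg)

end

text \<open>What the convergence proof uses of the averaged operators: every step \<open>T k\<close> is nonexpansive, and
  the decrease of the squared distance to a common point, multiplied by \<open>B\<close>, bounds both the squared
  length of the step and the squared distances to the sets \<open>C j\<close> with \<open>j\<close> in the set \<open>act k\<close> of
  indices active at time \<open>k\<close>. Every index is active at some time in each window of length \<open>s\<close>.\<close>

locale intermittent_operators =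
  fixes C :: "'i \<Rightarrow> 'a::{real_inner,complete_space} set" and I :: "'i set"
    and T :: "nat \<Rightarrow> 'a \<Rightarrow> 'a" and act :: "nat \<Rightarrow> 'i set" and B :: real and s :: nat
  assumes finite_I: "finite I" and I_ne: "I \<noteq> {}"
    and C_closed: "\<And>i. i \<in> I \<Longrightarrow> closed (C i)"
    and C_convex: "\<And>i. i \<in> I \<Longrightarrow> convex (C i)"
    and C_ne: "(\<Inter>i\<in>I. C i) \<noteq> {}"
    and B_pos: "B > 0" and s_pos: "s > 0"
    and control: "\<And>k. I \<subseteq> (\<Union>l\<in>{k..<k + s}. act l)"
    and nonexpansive: "\<And>k a b. norm (T k a - T k b) \<le> norm (a - b)"
    and displacement: "\<And>k a z. z \<in> (\<Inter>i\<in>I. C i) \<Longrightarrow>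
      (norm (T k a - a))\<^sup>2 \<le> B * ((norm (a - z))\<^sup>2 - (norm (T k a - z))\<^sup>2)"
    and proximity: "\<And>k a z j. z \<in> (\<Inter>i\<in>I. C i) \<Longrightarrow> j \<in> act k \<Longrightarrow>
      (infdist a (C j))\<^sup>2 \<le> B * ((norm (a - z))\<^sup>2 - (norm (T k a - z))\<^sup>2)"
begin

text \<open>The common points of the family, all of which are fixed by every \<open>T k\<close>.\<close>

definition Z where "Z = (\<Inter>i\<in>I. C i)"

lemma Z_closed: "closed Z" and Z_convex: "convex Z" and Z_ne: "Z \<noteq> {}"
  unfolding Z_def using C_closed C_convex C_ne by (auto intro!: closed_INT convex_INT)

lemma quasi_nonexpansive: "z \<in> Z \<Longrightarrow> norm (T k a - z) \<le> norm (a - z)"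
proof -
  assume "z \<in> Z"
  then have "0 \<le> B * ((norm (a - z))\<^sup>2 - (norm (T k a - z))\<^sup>2)"
    using displacement[of z k a] unfolding Z_def by (meson order_trans zero_le_power2)
  then show ?thesis
    using B_pos by (simp add: zero_le_mult_iff)
qed

lemma orbit_fejer:
  assumes "z \<in> Z" "m \<le> n"
  shows "norm (orbit T i a n - z) \<le> norm (orbit T i a m - z)"
  using lift_Suc_antimono_le[of "\<lambda>n. norm (orbit T i a n - z)", OF _ assms(2)]
    quasi_nonexpansive[OF assms(1)] by simp

lemma orbit_nonexpansive: "norm (orbit T i a n - orbit T i b n) \<le> norm (a - b)"
  by (induction n) (auto intro: order_trans[OF nonexpansive])

text \<open>An index activated \<open>m\<close> steps later still bounds the present distance to its set: by the triangle
  inequality along the orbit this distance is a sum of \<open>m + 1\<close> terms, each controlled by the decrease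
  of \<open>norm (_ - z)\<^sup>2\<close> in its own step.\<close>

lemma orbit_proximity_window:
  assumes "z \<in> Z" "j \<in> act (i + n + m)"
  shows "(infdist (orbit T i a n) (C j))\<^sup>2 \<le> (real m + 1) *
    (B * ((norm (orbit T i a n - z))\<^sup>2 - (norm (orbit T i a (n + Suc m) - z))\<^sup>2))"
  using assms(2)
proof (induction m arbitrary: n)
  case 0
  then show ?case
    using proximity[of z j "i + n" "orbit T i a n"] assms(1) by (simp add: Z_def)
next
  case (Suc m)
  let ?u = "orbit T i a"
  let ?E = "\<lambda>k l. (norm (?u k - z))\<^sup>2 - (norm (?u l - z))\<^sup>2"
  let ?a = "norm (?u (Suc n) - ?u n)" and ?b = "infdist (?u (Suc n)) (C j)"
  have "(infdist (?u n) (C j))\<^sup>2 \<le> (?a + ?b)\<^sup>2"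
    using infdist_triangle[of "?u n" "C j" "?u (Suc n)"]
    by (intro power_mono) (auto simp: dist_norm norm_minus_commute infdist_nonneg)
  also have "\<dots> \<le> ((real m + 1) + 1) * (?a\<^sup>2 + B * ?E (Suc n) (Suc n + Suc m))"
  proof (rule square_add_le)
    show "?b\<^sup>2 \<le> (real m + 1) * (B * ?E (Suc n) (Suc n + Suc m))"
      using Suc.IH[of "Suc n"] Suc.prems by simp
    have "(norm (?u (Suc n + Suc m) - z))\<^sup>2 \<le> (norm (?u (Suc n) - z))\<^sup>2"
      by (intro power_mono orbit_fejer assms(1)) auto
    then show "0 \<le> B * ?E (Suc n) (Suc n + Suc m)"
      using B_pos by simp
  qed auto
  also have "\<dots> \<le> ((real m + 1) + 1) * (B * ?E n (Suc n) + B * ?E (Suc n) (Suc n + Suc m))"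
    using displacement[of z "i + n" "?u n"] assms(1)
    by (intro mult_left_mono add_right_mono) (simp_all add: Z_def)
  also have "\<dots> = (real (Suc m) + 1) * (B * ?E n (n + Suc (Suc m)))"
    by (simp add: algebra_simps)
  finally show ?case .
qed

lemma orbit_proximity:
  assumes "z \<in> Z" "j \<in> I"
  shows "(infdist (orbit T i a n) (C j))\<^sup>2 \<le>
    real s * B * ((norm (orbit T i a n - z))\<^sup>2 - (norm (orbit T i a (n + s) - z))\<^sup>2)"
proof -
  obtain l where l: "l \<in> {i + n..<i + n + s}" "j \<in> act l"
    using control[of "i + n"] assms(2) by blast
  define m where "m = l - (i + n)"
  have m: "Suc m \<le> s" "j \<in> act (i + n + m)"
    using l by (auto simp: m_def)
  let ?u = "orbit T i a"
  let ?E = "\<lambda>k. (norm (?u n - z))\<^sup>2 - (norm (?u k - z))\<^sup>2"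
  have "(norm (?u (n + Suc m) - z))\<^sup>2 \<le> (norm (?u n - z))\<^sup>2"
    by (intro power_mono orbit_fejer assms(1)) auto
  then have E0: "0 \<le> ?E (n + Suc m)" by simp
  have E: "?E (n + Suc m) \<le> ?E (n + s)"
    using m(1) by (intro diff_left_mono power_mono orbit_fejer assms(1)) auto
  have "(infdist (?u n) (C j))\<^sup>2 \<le> (real m + 1) * (B * ?E (n + Suc m))"
    by (rule orbit_proximity_window[OF assms(1) m(2)])
  also have "\<dots> \<le> real s * (B * ?E (n + s))"
    using m(1) B_pos E E0 by (intro mult_mono) auto
  finally show ?thesis by (simp add: mult.assoc)
qed

lemma orbit_infdist_tendsto_0:
  assumes "j \<in> I"
  shows "(\<lambda>n. infdist (orbit T i a n) (C j)) \<longlonglongrightarrow> 0"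
proof -
  obtain z where z: "z \<in> Z" using Z_ne by blast
  define g where "g n = (norm (orbit T i a n - z))\<^sup>2" for n
  have "decseq g"
    unfolding decseq_def g_def by (intro allI impI power_mono orbit_fejer z) auto
  then obtain L where L: "g \<longlonglongrightarrow> L"
    using decseq_convergent[of g 0] by (auto simp: g_def)
  have "(\<lambda>n. (infdist (orbit T i a n) (C j))\<^sup>2) \<longlonglongrightarrow> 0"
  proof (rule tendsto_sandwich[OF _ _ tendsto_const])
    have "(\<lambda>n. real s * B * (g n - g (n + s))) \<longlonglongrightarrow> real s * B * (L - L)"
      by (intro tendsto_intros L LIMSEQ_ignore_initial_segment)
    then show "(\<lambda>n. real s * B * (g n - g (n + s))) \<longlonglongrightarrow> 0" by simp
  qed (use orbit_proximity[OF z assms] in \<open>auto simp: g_def\<close>)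
  from tendsto_real_sqrt[OF this] show ?thesis
    by (simp add: infdist_nonneg)
qed

lemma orbit_max_dist_tendsto_0: "(\<lambda>n. max_dist I C (orbit T i a n)) \<longlonglongrightarrow> 0"
  by (rule max_dist_tendsto_0[OF finite_I I_ne orbit_infdist_tendsto_0])

lemma orbit_weakly_converges:
  obtains p where "p \<in> Z" "weakly_converges (orbit T i a) p"
    "\<And>n. norm (orbit T i a n - p) \<le> 2 * infdist (orbit T i a n) Z"
proof -
  have "norm (orbit T i a (Suc n) - z) \<le> norm (orbit T i a n - z)" if "z \<in> (\<Inter>i\<in>I. C i)" for z n
    using orbit_fejer[of z n "Suc n" i a] that unfolding Z_def by simp
  from fejer_weakly_converges[OF C_closed C_convex C_ne this orbit_infdist_tendsto_0] that
  show ?thesis unfolding Z_def by blast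
qed

lemma orbit_bounded: "bounded (range (orbit T i a))"
proof -
  obtain z where z: "z \<in> Z" using Z_ne by blast
  have "range (orbit T i a) \<subseteq> cball z (norm (a - z))"
    using orbit_fejer[OF z, of 0 _ i a] by (auto simp: dist_norm norm_minus_commute)
  then show ?thesis
    using bounded_cball bounded_subset by blast
qed

lemma orbit_converges:
  assumes "boundedly_regular I C"
    and p: "\<And>n. norm (orbit T i a n - p) \<le> 2 * infdist (orbit T i a n) Z"
  shows "orbit T i a \<longlonglongrightarrow> p"
proof -
  have "(\<lambda>n. infdist (orbit T i a n) Z) \<longlonglongrightarrow> 0"
    using assms(1) orbit_bounded[of i a] orbit_max_dist_tendsto_0[of i a]
    unfolding boundedly_regular_def regular_over_def Z_def by blast
  then have "(\<lambda>n. 2 * infdist (orbit T i a n) Z) \<longlonglongrightarrow> 0"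
    using tendsto_mult_right_zero by blast
  then have "(\<lambda>n. orbit T i a n - p) \<longlonglongrightarrow> 0"
    by (rule Lim_null_comparison[rotated]) (use p in simp)
  then show ?thesis
    by (simp add: LIM_zero_iff)
qed

text \<open>Let \<open>z\<close> be the projection of the current point onto \<open>Z\<close>. Linear regularity bounds
  \<open>(infdist _ Z)\<^sup>2\<close> by \<open>\<kappa>\<^sup>2 s B\<close> times the decrease of \<open>norm (_ - z)\<^sup>2\<close> over the next \<open>s\<close> steps, which is
  at most the decrease of \<open>(infdist _ Z)\<^sup>2\<close> over these steps. So \<open>s\<close> steps contract the distance to
  \<open>Z\<close> by a fixed factor. The constants are the same for all starting times and points of orbits within \<open>S\<close>.\<close>

lemma orbit_linear_rate:
  assumes reg: "linearly_regular_over I C \<kappa> S"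
  obtains K q where "K > 0" "0 < q" "q < 1"
    "\<And>i a n. (\<And>n. orbit T i a n \<in> S) \<Longrightarrow>
      infdist (orbit T i a n) Z \<le> K * q ^ n * infdist a Z"
proof -
  \<comment> \<open>The lower bound \<open>2\<close> only ensures that \<open>1 - 1 / A\<close> is positive.\<close>
  define A where "A = max 2 (\<kappa>\<^sup>2 * (real s * B))"
  define q where "q = root (2 * s) (1 - 1 / A)"
  have A: "A \<ge> 2" "A \<ge> \<kappa>\<^sup>2 * (real s * B)" "0 < 1 - 1 / A" "1 - 1 / A < 1"
    by (auto simp: A_def field_simps)
  have q: "0 < q" "q < 1"
    using A s_pos real_root_lt_1_iff[of "2 * s" "1 - 1 / A"] by (auto simp: q_def)
  have qs: "(q ^ s)\<^sup>2 = 1 - 1 / A"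
    using A s_pos real_root_pow_pos2[of "2 * s" "1 - 1 / A"]
    by (simp add: q_def power_mult[symmetric] mult.commute)
  have "infdist (orbit T i a n) Z \<le> inverse (q ^ s) * q ^ n * infdist a Z"
    if S: "\<And>n. orbit T i a n \<in> S" for i a n
  proof -
    define D where "D n = infdist (orbit T i a n) Z" for n
    have D_eq: "D m = norm (orbit T i a m - metric_proj Z (orbit T i a m))" for m
      by (simp add: D_def infdist_eq_dist_metric_proj Z_closed Z_convex Z_ne dist_norm)
    have D_le: "D n \<le> norm (orbit T i a n - z)" if "z \<in> Z" for n z
      using infdist_le[OF that, of "orbit T i a n"] by (simp add: D_def dist_norm)
    have D0: "0 \<le> D n" for n by (simp add: D_def infdist_nonneg)
    have D_mono: "D n \<le> D m" if "m \<le> n" for m n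
    proof -
      have z: "metric_proj Z (orbit T i a m) \<in> Z"
        by (rule metric_proj_in[OF Z_closed Z_convex Z_ne])
      show ?thesis
        using D_le[OF z, of n] orbit_fejer[OF z that, of i a] D_eq[of m] by linarith
    qed
    have block: "D (n + s) \<le> q ^ s * D n" for n
    proof -
      define z where "z = metric_proj Z (orbit T i a n)"
      have z: "z \<in> Z"
        unfolding z_def by (rule metric_proj_in[OF Z_closed Z_convex Z_ne])
      let ?E = "(D n)\<^sup>2 - (D (n + s))\<^sup>2"
      have "(D (n + s))\<^sup>2 \<le> (D n)\<^sup>2"
        by (intro power_mono D_mono D0) simp
      then have E0: "0 \<le> ?E" by simp
      have Dz: "(D (n + s))\<^sup>2 \<le> (norm (orbit T i a (n + s) - z))\<^sup>2"
        by (intro power_mono D_le z D0)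
      obtain j where j: "j \<in> I" "max_dist I C (orbit T i a n) = infdist (orbit T i a n) (C j)"
        using max_dist_attained[OF finite_I I_ne] by metis
      have "D n \<le> \<kappa> * infdist (orbit T i a n) (C j)"
        using reg S[of n] unfolding linearly_regular_over_def D_def Z_def j(2)[symmetric] by blast
      then have "(D n)\<^sup>2 \<le> (\<kappa> * infdist (orbit T i a n) (C j))\<^sup>2"
        by (intro power_mono D0)
      also have "\<dots> = \<kappa>\<^sup>2 * (infdist (orbit T i a n) (C j))\<^sup>2"
        by (simp add: power_mult_distrib)
      also have "\<dots> \<le> \<kappa>\<^sup>2 * (real s * B * ((norm (orbit T i a n - z))\<^sup>2
          - (norm (orbit T i a (n + s) - z))\<^sup>2))"
        by (intro mult_left_mono orbit_proximity z j) simp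
      also have "\<dots> \<le> \<kappa>\<^sup>2 * (real s * B * ?E)"
        using Dz B_pos by (intro mult_left_mono) (auto simp: z_def D_eq)
      also have "\<dots> \<le> A * ?E"
        using mult_right_mono[OF A(2) E0] by (simp add: mult.assoc)
      finally have "(D (n + s))\<^sup>2 \<le> (1 - 1 / A) * (D n)\<^sup>2"
        using A(1) by (simp add: field_simps)
      then have "(D (n + s))\<^sup>2 \<le> (q ^ s * D n)\<^sup>2"
        by (simp add: power_mult_distrib qs)
      then show ?thesis
        by (rule power2_le_imp_le) (use q D0 in auto)
    qed
    \<comment> \<open>The factor \<open>q ^ s\<close> absorbs the last, incomplete block of steps.\<close>
    have "D n * q ^ s \<le> q ^ n * D 0"
    proof (induction n rule: less_induct)
      case (less n)
      show ?case
      proof (cases "n < s")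
        case True
        have "q ^ s \<le> q ^ n"
          using True q by (intro power_decreasing) auto
        then show ?thesis
          using D_mono[of 0 n] D0 q mult_mono[of "D n" "D 0" "q ^ s" "q ^ n"]
          by (simp add: mult.commute)
      next
        case False
        then obtain m where m: "n = m + s" by (metis add.commute le_Suc_ex not_less)
        have "D n * q ^ s \<le> q ^ s * (D m * q ^ s)"
          using mult_right_mono[OF block[of m], of "q ^ s"] q by (simp add: m mult.assoc)
        also have "\<dots> \<le> q ^ s * (q ^ m * D 0)"
          using less[of m] s_pos q by (intro mult_left_mono) (auto simp: m)
        finally show ?thesis
          by (simp add: m power_add mult_ac)
      qed
    qed
    then show ?thesis
      using q by (simp add: D_def field_simps)
  qed
  then show ?thesis
    using that[of "inverse (q ^ s)" q] q by simp
qed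

end

section \<open>Inexact orbits\<close>

text \<open>A trajectory whose \<open>k\<close>-th step deviates from \<open>T k\<close> by at most \<open>e k\<close>, with summable errors.\<close>

locale inexact_orbit = intermittent_operators +
  fixes x :: "nat \<Rightarrow> 'b" and e :: "nat \<Rightarrow> real"
  assumes inexact: "\<And>k. norm (x (Suc k) - T k (x k)) \<le> e k"
    and e_summable: "summable e"
begin

text \<open>The total error committed from time \<open>i\<close> on.\<close>

definition tail :: "nat \<Rightarrow> real" where "tail i = (\<Sum>j. e (i + j))"

lemma e_nonneg: "0 \<le> e k"
  using inexact[of k] norm_ge_zero order_trans by blast

lemma e_shift_summable: "summable (\<lambda>j. e (i + j))"
  using e_summable by (simp add: add.commute)

lemma tail_Suc: "tail i = e i + tail (Suc i)"
  using suminf_split_head[OF e_shift_summable, of i] by (simp add: tail_def)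

lemma tail_nonneg: "0 \<le> tail i"
  unfolding tail_def by (rule suminf_nonneg[OF e_shift_summable e_nonneg])

lemma tail_antimono: "i \<le> k \<Longrightarrow> tail k \<le> tail i"
proof (rule lift_Suc_antimono_le)
  show "tail (Suc n) \<le> tail n" for n
    using tail_Suc[of n] e_nonneg[of n] by linarith
qed

lemma tail_tendsto_0: "tail \<longlonglongrightarrow> 0"
proof -
  have "(\<lambda>i. suminf e - (\<Sum>j<i. e j)) \<longlonglongrightarrow> suminf e - suminf e"
    by (intro tendsto_intros summable_LIMSEQ e_summable)
  then show ?thesis
    using suminf_minus_initial_segment[OF e_summable]
    by (simp add: tail_def[abs_def] add.commute)
qed

lemma norm_diff_le_tail:
  assumes "\<And>n. norm (f (Suc n) - g (Suc n)) \<le> norm (f n - g n) + e (i + n)" "f 0 = g 0"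
  shows "norm (f n - g n) \<le> tail i - tail (i + n)"
proof (induction n)
  case (Suc n)
  then show ?case
    using assms(1)[of n] tail_Suc[of "i + n"] by simp
qed (use assms in simp)

lemma dist_orbit_le_tail: "norm (x (i + n) - orbit T i (x i) n) \<le> tail i"
proof -
  have "norm (x (i + n) - orbit T i (x i) n) \<le> tail i - tail (i + n)"
  proof (rule norm_diff_le_tail[of "\<lambda>n. x (i + n)"])
    fix n
    have "norm (x (i + Suc n) - orbit T i (x i) (Suc n)) \<le>
        norm (x (Suc (i + n)) - T (i + n) (x (i + n)))
        + norm (T (i + n) (x (i + n)) - T (i + n) (orbit T i (x i) n))"
      using norm_triangle_ineq[of "x (Suc (i + n)) - T (i + n) (x (i + n))"
          "T (i + n) (x (i + n)) - T (i + n) (orbit T i (x i) n)"] by simp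
    then show "norm (x (i + Suc n) - orbit T i (x i) (Suc n)) \<le>
        norm (x (i + n) - orbit T i (x i) n) + e (i + n)"
      using inexact[of "i + n"] nonexpansive[of "i + n" "x (i + n)" "orbit T i (x i) n"] by linarith
  qed simp
  then show ?thesis
    using tail_nonneg[of "i + n"] by linarith
qed

text \<open>The weak limits \<open>xlim i\<close> of the exact orbits started at the points \<open>x i\<close> form a Cauchy sequence:
  consecutive orbits stay within \<open>e i\<close> of each other, and so do their weak limits, by weak lower
  semicontinuity of the norm.\<close>

lemma limits:
  obtains xinf xlim where "xinf \<in> Z" "\<And>i. xlim i \<in> Z"
    "\<And>i. weakly_converges (orbit T i (x i)) (xlim i)"
    "\<And>i n. norm (orbit T i (x i) n - xlim i) \<le> 2 * infdist (orbit T i (x i) n) Z"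
    "xlim \<longlonglongrightarrow> xinf" "\<And>i. norm (xlim i - xinf) \<le> tail i"
proof -
  have "\<forall>i. \<exists>p. p \<in> Z \<and> weakly_converges (orbit T i (x i)) p \<and>
      (\<forall>n. norm (orbit T i (x i) n - p) \<le> 2 * infdist (orbit T i (x i) n) Z)"
    using orbit_weakly_converges by metis
  then obtain xlim where xlim: "\<And>i. xlim i \<in> Z" "\<And>i. weakly_converges (orbit T i (x i)) (xlim i)"
      "\<And>i n. norm (orbit T i (x i) n - xlim i) \<le> 2 * infdist (orbit T i (x i) n) Z"
    by metis
  have step: "norm (xlim (Suc i) - xlim i) \<le> e i" for i
  proof (rule weakly_converges_norm_le)
    have "weakly_converges (\<lambda>n. orbit T i (x i) (Suc n)) (xlim i)"
      using xlim(2)[of i] unfolding weakly_converges_def by (intro allI) (rule LIMSEQ_Suc, blast)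
    then show "weakly_converges (\<lambda>n. orbit T (Suc i) (x (Suc i)) n - orbit T i (x i) (Suc n))
        (xlim (Suc i) - xlim i)"
      by (rule weakly_converges_diff[OF xlim(2)])
    show "\<forall>\<^sub>F n in sequentially.
        norm (orbit T (Suc i) (x (Suc i)) n - orbit T i (x i) (Suc n)) \<le> e i"
      unfolding orbit_Suc_shift using orbit_nonexpansive inexact[of i]
      by (intro always_eventually allI) (meson order_trans)
  qed
  have diff: "norm (xlim (i + n) - xlim i) \<le> tail i" for i n
  proof -
    have "norm (xlim (i + n) - xlim i) \<le> tail i - tail (i + n)"
    proof (rule norm_diff_le_tail[of "\<lambda>n. xlim (i + n)" "\<lambda>n. xlim i"])
      fix n
      show "norm (xlim (i + Suc n) - xlim i) \<le> norm (xlim (i + n) - xlim i) + e (i + n)"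
        using step[of "i + n"] norm_triangle_ineq[of "xlim (i + Suc n) - xlim (i + n)"
            "xlim (i + n) - xlim i"] by simp
    qed simp
    then show ?thesis
      using tail_nonneg[of "i + n"] by linarith
  qed
  have "Cauchy xlim"
  proof (rule Cauchy_dist_sq_le)
    fix m n :: nat assume "m \<le> n"
    then show "(dist (xlim m) (xlim n))\<^sup>2 \<le> (tail m)\<^sup>2"
      using diff[of m "n - m"] by (intro power_mono) (auto simp: dist_norm norm_minus_commute)
  next
    show "(\<lambda>m. (tail m)\<^sup>2) \<longlonglongrightarrow> 0"
      using tendsto_power[OF tail_tendsto_0, of 2] by simp
  qed
  then obtain xinf where xinf: "xlim \<longlonglongrightarrow> xinf"
    using Cauchy_convergent_iff convergent_def by blast
  have "norm (xlim i - xinf) \<le> tail i" for i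
  proof (rule tendsto_upperbound)
    show "(\<lambda>n. norm (xlim i - xlim (n + i))) \<longlonglongrightarrow> norm (xlim i - xinf)"
      by (intro tendsto_intros LIMSEQ_ignore_initial_segment xinf)
    show "\<forall>\<^sub>F n in sequentially. norm (xlim i - xlim (n + i)) \<le> tail i"
      using diff[of i] by (simp add: norm_minus_commute add.commute)
  qed simp
  moreover have "xinf \<in> Z"
    using closed_sequentially[OF Z_closed _ xinf] xlim(1) by blast
  ultimately show ?thesis
    using that xlim xinf by blast
qed

lemma inexact_fejer:
  assumes "z \<in> Z"
  shows "norm (orbit T i (x i) n - z) \<le> norm (x 0 - z) + tail 0"
proof -
  have "norm (orbit T i (x i) n - z) \<le> norm (x i - z)"
    using orbit_fejer[OF assms, of 0 n i "x i"] by simp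
  also have "\<dots> \<le> norm (x (0 + i) - orbit T 0 (x 0) i) + norm (orbit T 0 (x 0) i - z)"
    using norm_triangle_ineq[of "x i - orbit T 0 (x 0) i" "orbit T 0 (x 0) i - z"] by simp
  also have "\<dots> \<le> norm (x 0 - z) + tail 0"
    using dist_orbit_le_tail[of 0 i] orbit_fejer[OF assms, of 0 i 0 "x 0"] by simp
  finally show ?thesis .
qed

lemma weak_limits:
  "\<exists>xinf xlim.
     xinf \<in> Z \<and> (\<forall>i. xlim i \<in> Z) \<and>
     (\<forall>i. weakly_converges (\<lambda>k. iterate_ops T k i (x i)) (xlim i)) \<and>
     (boundedly_regular I C \<longrightarrow> (\<forall>i. (\<lambda>k. iterate_ops T k i (x i)) \<longlonglongrightarrow> xlim i)) \<and>
     xlim \<longlonglongrightarrow> xinf \<and>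
     (\<forall>y k i. i \<le> k \<longrightarrow> \<bar>y \<bullet> (x (k+1) - xinf)\<bar> \<le>
        \<bar>y \<bullet> (iterate_ops T k i (x i) - xlim i)\<bar> + 2 * norm y * tail i) \<and>
     (\<forall>k i. i \<le> k \<longrightarrow> norm (x (k+1) - xinf) \<le>
        norm (iterate_ops T k i (x i) - xlim i) + 2 * tail i)"
proof -
  obtain xinf xlim where lims: "xinf \<in> Z" "\<And>i. xlim i \<in> Z"
    "\<And>i. weakly_converges (orbit T i (x i)) (xlim i)"
    "\<And>i n. norm (orbit T i (x i) n - xlim i) \<le> 2 * infdist (orbit T i (x i) n) Z"
    "xlim \<longlonglongrightarrow> xinf" "\<And>i. norm (xlim i - xinf) \<le> tail i"
    using limits by blast
  have weak: "weakly_converges (\<lambda>k. iterate_ops T k i (x i)) (xlim i)" for i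
    using lims(3)[of i] unfolding weakly_converges_def
    by (intro allI tendsto_iterate_ops[where f = "\<lambda>u. _ \<bullet> u"]) blast
  have strong: "(\<lambda>k. iterate_ops T k i (x i)) \<longlonglongrightarrow> xlim i" if "boundedly_regular I C" for i
    by (rule tendsto_iterate_ops[where f = "\<lambda>u. u"]) (rule orbit_converges[OF that lims(4)])
  have near: "norm (x (k+1) - iterate_ops T k i (x i)) \<le> tail i" if "i \<le> k" for i k
    using dist_orbit_le_tail[of i "Suc (k - i)"] iterate_ops_eq_orbit[of T i "k - i" "x i"] that
    by simp
  have bound1: "\<bar>y \<bullet> (x (k+1) - xinf)\<bar> \<le>
      \<bar>y \<bullet> (iterate_ops T k i (x i) - xlim i)\<bar> + 2 * norm y * tail i" if "i \<le> k" for y k i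
  proof -
    let ?u = "iterate_ops T k i (x i)"
    have "y \<bullet> (x (k+1) - xinf) =
        y \<bullet> (?u - xlim i) + y \<bullet> (x (k+1) - ?u) + y \<bullet> (xlim i - xinf)"
      by (simp add: inner_diff_right)
    moreover have "\<bar>y \<bullet> (x (k+1) - ?u)\<bar> \<le> norm y * tail i"
      using Cauchy_Schwarz_ineq2[of y "x (k+1) - ?u"] near[OF that]
      by (meson mult_left_mono norm_ge_zero order_trans)
    moreover have "\<bar>y \<bullet> (xlim i - xinf)\<bar> \<le> norm y * tail i"
      using Cauchy_Schwarz_ineq2[of y "xlim i - xinf"] lims(6)[of i]
      by (meson mult_left_mono norm_ge_zero order_trans)
    ultimately show ?thesis by linarith
  qed
  have bound2: "norm (x (k+1) - xinf) \<le> norm (iterate_ops T k i (x i) - xlim i) + 2 * tail i"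
    if "i \<le> k" for k i
  proof -
    let ?u = "iterate_ops T k i (x i)"
    have "norm (x (k+1) - xinf) \<le> norm (?u - xlim i) + norm (x (k+1) - ?u) + norm (xlim i - xinf)"
      using norm_triangle_ineq[of "(?u - xlim i) + (x (k+1) - ?u)" "xlim i - xinf"]
        norm_triangle_ineq[of "?u - xlim i" "x (k+1) - ?u"] by simp
    then show ?thesis
      using near[OF that] lims(6)[of i] by linarith
  qed
  show ?thesis
    using lims weak strong bound1 bound2 by blast
qed

text \<open>The upper bound compares \<open>x\<close> with the exact orbit started at time \<open>i\<close>, the lower bound with the
  limit of the orbit started at time \<open>k + 1\<close>. All these orbits lie in one ball, so one regularity
  constant serves them all.\<close>

lemma linear_rate:
  assumes "boundedly_linearly_regular I C"
  shows "\<exists>\<kappa> c q xinf. \<kappa> > 0 \<and> c > 0 \<and> q \<in> {0<..<1} \<and> xinf \<in> Z \<and>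
    (\<forall>k i. i \<le> k \<longrightarrow>
       1 / (2 * \<kappa>) * norm (x (k+1) - xinf) - 2 * tail i \<le> max_dist I C (x (k+1)) \<and>
       max_dist I C (x (k+1)) \<le> c * q ^ (k - i) + 2 * tail i)"
proof -
  obtain xinf xlim where lims: "xinf \<in> Z"
    "\<And>i n. norm (orbit T i (x i) n - xlim i) \<le> 2 * infdist (orbit T i (x i) n) Z"
    "\<And>i. norm (xlim i - xinf) \<le> tail i"
    by (rule limits) (rule that)
  define R where "R = norm (x 0 - xinf) + tail 0"
  have in_S: "orbit T i (x i) n \<in> cball xinf R" for i n
    using inexact_fejer[OF lims(1), of i n] by (simp add: R_def dist_norm norm_minus_commute)
  have "\<exists>\<kappa>. linearly_regular_over I C \<kappa> (cball xinf R)"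
    using assms bounded_cball unfolding boundedly_linearly_regular_def by blast
  then obtain \<kappa>' where \<kappa>': "linearly_regular_over I C \<kappa>' (cball xinf R)"
    by blast
  obtain K q where K: "K > 0" "0 < q" "q < 1"
    "\<And>i a n. (\<And>n. orbit T i a n \<in> cball xinf R) \<Longrightarrow>
      infdist (orbit T i a n) Z \<le> K * q ^ n * infdist a Z"
    using orbit_linear_rate[OF \<kappa>'] by blast
  \<comment> \<open>Enlarging the constant to at least \<open>1\<close> gives \<open>tail i \<le> 2 * \<kappa> * (2 * tail i)\<close> in the lower bound.\<close>
  define \<kappa> where "\<kappa> = max 1 \<kappa>'"
  have x_reg: "infdist (x k) Z \<le> \<kappa> * max_dist I C (x k)" for k
  proof -
    have "infdist (x k) Z \<le> \<kappa>' * max_dist I C (x k)"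
      using \<kappa>' in_S[of k 0] unfolding linearly_regular_over_def Z_def by simp
    also have "\<dots> \<le> \<kappa> * max_dist I C (x k)"
      by (intro mult_right_mono max_dist_nonneg finite_I I_ne) (simp add: \<kappa>_def)
    finally show ?thesis .
  qed
  have \<kappa>1: "1 \<le> \<kappa>" by (simp add: \<kappa>_def)
  have R0: "0 \<le> R" by (simp add: R_def tail_nonneg)
  have "1 / (2 * \<kappa>) * norm (x (k+1) - xinf) - 2 * tail i \<le> max_dist I C (x (k+1))"
    if "i \<le> k" for k i
  proof -
    have "norm (x (k+1) - xinf) \<le> norm (x (k+1) - xlim (k+1)) + norm (xlim (k+1) - xinf)"
      using norm_triangle_ineq[of "x (k+1) - xlim (k+1)" "xlim (k+1) - xinf"] by simp
    also have "\<dots> \<le> 2 * infdist (x (k+1)) Z + tail i"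
      using lims(2)[of "k+1" 0] lims(3)[of "k+1"] tail_antimono[of i "k+1"] that by simp
    also have "\<dots> \<le> 2 * (\<kappa> * max_dist I C (x (k+1))) + (2 * \<kappa>) * (2 * tail i)"
    proof (intro add_mono mult_left_mono x_reg)
      show "tail i \<le> (2 * \<kappa>) * (2 * tail i)"
        using mult_right_mono[of 1 "4 * \<kappa>" "tail i"] tail_nonneg[of i] \<kappa>1 by simp
    qed simp
    also have "\<dots> = 2 * \<kappa> * (max_dist I C (x (k+1)) + 2 * tail i)"
      by (simp add: algebra_simps)
    finally show ?thesis
      using \<kappa>1 by (simp add: field_simps)
  qed
  moreover have "max_dist I C (x (k+1)) \<le> K * (R + 1) * q ^ (k - i) + 2 * tail i"
    if "i \<le> k" for k i
  proof -
    define u where "u = orbit T i (x i) (Suc (k - i))"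
    have near: "norm (x (k+1) - u) \<le> tail i"
      using dist_orbit_le_tail[of i "Suc (k - i)"] that by (simp add: u_def)
    have "infdist (x i) Z \<le> R + 1"
      using infdist_le[OF lims(1), of "x i"] in_S[of i 0] by (simp add: dist_commute)
    moreover have "q ^ Suc (k - i) \<le> q ^ (k - i)"
      using K by (intro power_decreasing) auto
    ultimately have "K * q ^ Suc (k - i) * infdist (x i) Z \<le> K * q ^ (k - i) * (R + 1)"
      using K(1,2) by (intro mult_mono) (auto simp: infdist_nonneg)
    then have "infdist u Z \<le> K * (R + 1) * q ^ (k - i)"
      using K(4)[OF in_S, of i "Suc (k - i)"] unfolding u_def by (simp add: mult_ac)
    moreover have "max_dist I C (x (k+1)) \<le> infdist (x (k+1)) Z"
      unfolding Z_def by (rule max_dist_le_infdist_Inter[OF finite_I I_ne C_ne])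
    moreover have "infdist (x (k+1)) Z \<le> infdist u Z + norm (x (k+1) - u)"
      using infdist_triangle[of "x (k+1)" Z u] by (simp add: dist_norm)
    ultimately show ?thesis
      using near tail_nonneg[of i] by linarith
  qed
  ultimately show ?thesis
    using K lims(1) R0 by (intro exI[of _ \<kappa>] exI[of _ "K * (R + 1)"] exI[of _ q] exI[of _ xinf])
      (use \<kappa>1 in auto)
qed

end

section \<open>String averages of projections\<close>

lemma string_proj_Nil [simp]: "string_proj C [] a = a"
  by (simp add: string_proj_def)

lemma string_proj_Cons [simp]:
  "string_proj C (j # L) a = string_proj C L (metric_proj (C j) a)"
  by (simp add: string_proj_def)

lemma string_proj_nonexpansive:
  assumes "\<And>j. j \<in> set L \<Longrightarrow> closed (C j) \<and> convex (C j) \<and> C j \<noteq> {}"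
  shows "norm (string_proj C L a - string_proj C L b) \<le> norm (a - b)"
  using assms
proof (induction L arbitrary: a b)
  case (Cons j L)
  then have "norm (string_proj C (j # L) a - string_proj C (j # L) b)
      \<le> norm (metric_proj (C j) a - metric_proj (C j) b)"
    by simp
  also have "\<dots> \<le> norm (a - b)"
    using Cons.prems by (intro metric_proj_nonexpansive) auto
  finally show ?case .
qed simp

text \<open>Each projection decreases the squared distance to \<open>z\<close> by at least its squared step length, and
  the partial products of the string visit each of its sets.\<close>

lemma string_proj_decrease:
  assumes "\<And>j. j \<in> set L \<Longrightarrow> closed (C j) \<and> convex (C j) \<and> z \<in> C j"
  defines "E \<equiv> \<lambda>a. (norm (a - z))\<^sup>2 - (norm (string_proj C L a - z))\<^sup>2"
  shows "0 \<le> E a"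
    and "(norm (string_proj C L a - a))\<^sup>2 \<le> real (length L) * E a"
    and "\<forall>j\<in>set L. (infdist a (C j))\<^sup>2 \<le> real (length L) * E a"
proof -
  have "0 \<le> E a \<and> (norm (string_proj C L a - a))\<^sup>2 \<le> real (length L) * E a \<and>
      (\<forall>j\<in>set L. (infdist a (C j))\<^sup>2 \<le> real (length L) * E a)"
    using assms(1) unfolding E_def
  proof (induction L arbitrary: a)
    case (Cons i L)
    let ?p = "metric_proj (C i) a"
    let ?q = "string_proj C L ?p"
    let ?E = "(norm (?p - z))\<^sup>2 - (norm (?q - z))\<^sup>2"
    let ?F = "(norm (a - z))\<^sup>2 - (norm (?q - z))\<^sup>2"
    have C: "closed (C i)" "convex (C i)" "z \<in> C i"
      using Cons.prems[of i] by auto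
    have IH: "0 \<le> ?E" "(norm (?q - ?p))\<^sup>2 \<le> real (length L) * ?E"
      "\<And>j. j \<in> set L \<Longrightarrow> (infdist ?p (C j))\<^sup>2 \<le> real (length L) * ?E"
      using Cons.IH[of ?p] Cons.prems by auto
    have F: "(norm (a - ?p))\<^sup>2 + ?E \<le> ?F"
      using metric_proj_Pythagoras[OF C, of a] by simp
    have combine: "(norm (a - ?p) + b)\<^sup>2 \<le> real (length (i # L)) * ?F"
      if "b\<^sup>2 \<le> real (length L) * ?E" for b
    proof -
      have "(norm (a - ?p) + b)\<^sup>2 \<le> (real (length L) + 1) * ((norm (a - ?p))\<^sup>2 + ?E)"
        using that IH(1) by (intro square_add_le) auto
      also have "\<dots> \<le> (real (length L) + 1) * ?F"
        by (intro mult_left_mono F) simp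
      finally show ?thesis by (simp add: add.commute)
    qed
    have "(norm (?q - a))\<^sup>2 \<le> (norm (a - ?p) + norm (?q - ?p))\<^sup>2"
      using norm_triangle_ineq4[of "?q - ?p" "a - ?p"] by (intro power_mono) auto
    then have "(norm (?q - a))\<^sup>2 \<le> real (length (i # L)) * ?F"
      using combine[OF IH(2)] by linarith
    moreover have "(infdist a (C j))\<^sup>2 \<le> real (length (i # L)) * ?F" if j: "j \<in> set (i # L)" for j
    proof (cases "j = i")
      case True
      have "infdist a (C i) \<le> norm (a - ?p)"
        using infdist_le[OF metric_proj_in[of "C i" a], of a] C by (auto simp: dist_norm)
      then have "(infdist a (C j))\<^sup>2 \<le> (norm (a - ?p) + 0)\<^sup>2"
        using True by (intro power_mono) (auto simp: infdist_nonneg)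
      also have "\<dots> \<le> real (length (i # L)) * ?F"
        by (rule combine) (use IH(1) in simp)
      finally show ?thesis .
    next
      case False
      have "(infdist a (C j))\<^sup>2 \<le> (norm (a - ?p) + infdist ?p (C j))\<^sup>2"
        using infdist_triangle[of a "C j" ?p]
        by (intro power_mono) (auto simp: dist_norm infdist_nonneg)
      also have "\<dots> \<le> real (length (i # L)) * ?F"
        by (rule combine) (use IH(3) j False in simp)
      finally show ?thesis .
    qed
    moreover have "0 \<le> ?F"
      using F IH(1) by (smt (verit) zero_le_power2)
    ultimately show ?case
      by (simp only: string_proj_Cons) blast
  qed simp
  then show "0 \<le> E a"
    and "(norm (string_proj C L a - a))\<^sup>2 \<le> real (length L) * E a"
    and "\<forall>j\<in>set L. (infdist a (C j))\<^sup>2 \<le> real (length L) * E a"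
    by blast+
qed

lemma norm_sq_convex_combination_le:
  fixes f :: "'i \<Rightarrow> 'a::real_inner"
  assumes "\<And>i. i \<in> A \<Longrightarrow> 0 \<le> w i" "sum w A = 1"
  shows "(norm (\<Sum>i\<in>A. w i *\<^sub>R f i))\<^sup>2 \<le> (\<Sum>i\<in>A. w i * (norm (f i))\<^sup>2)"
proof -
  define m where "m = (\<Sum>i\<in>A. w i *\<^sub>R f i)"
  \<comment> \<open>The difference of the two sides of the claim is the variance of \<open>f\<close> about its weighted mean.\<close>
  have "0 \<le> (\<Sum>i\<in>A. w i * (norm (f i - m))\<^sup>2)"
    using assms by (intro sum_nonneg) auto
  also have "\<dots> = (\<Sum>i\<in>A. w i * (norm (f i))\<^sup>2 - 2 * ((w i *\<^sub>R f i) \<bullet> m) + w i * (m \<bullet> m))"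
    by (intro sum.cong refl) (simp add: power2_norm_eq_inner inner_diff inner_commute algebra_simps)
  also have "\<dots> = (\<Sum>i\<in>A. w i * (norm (f i))\<^sup>2) - 2 * ((\<Sum>i\<in>A. w i *\<^sub>R f i) \<bullet> m) + sum w A * (m \<bullet> m)"
    by (simp only: sum.distrib sum_subtractf sum_distrib_left sum_distrib_right inner_sum_left)
  finally show ?thesis
    using assms(2) by (simp add: m_def power2_norm_eq_inner)
qed

context
  fixes C :: "nat \<Rightarrow> 'a::{real_inner,complete_space} set" and I :: "nat set"
    and N :: nat and J :: "nat \<Rightarrow> nat list" and w :: "nat \<Rightarrow> real"
  assumes C: "\<And>i. i \<in> I \<Longrightarrow> closed (C i)" "\<And>i. i \<in> I \<Longrightarrow> convex (C i)" "(\<Inter>i\<in>I. C i) \<noteq> {}"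
    and J: "\<And>n. n \<in> {1..N} \<Longrightarrow> set (J n) \<subseteq> I"
    and w_nonneg: "\<And>n. n \<in> {1..N} \<Longrightarrow> 0 \<le> w n"
    and w_sum: "(\<Sum>n=1..N. w n) = 1"
begin

lemma string_average_diff:
  "string_average C N J w a - b = (\<Sum>n=1..N. w n *\<^sub>R (string_proj C (J n) a - b))"
  using w_sum by (simp add: string_average_def scaleR_diff_right sum_subtractf
      scaleR_sum_left[symmetric])

lemma string_average_nonexpansive:
  "norm (string_average C N J w a - string_average C N J w b) \<le> norm (a - b)"
proof -
  have "norm (string_average C N J w a - string_average C N J w b) =
      norm (\<Sum>n=1..N. w n *\<^sub>R (string_proj C (J n) a - string_proj C (J n) b))"
    by (simp add: string_average_def scaleR_diff_right sum_subtractf)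
  also have "\<dots> \<le> (\<Sum>n=1..N. w n * norm (a - b))"
  proof (rule sum_norm_le)
    fix n assume n: "n \<in> {1..N}"
    have "norm (string_proj C (J n) a - string_proj C (J n) b) \<le> norm (a - b)"
      using C J[OF n] by (intro string_proj_nonexpansive) blast
    then show "norm (w n *\<^sub>R (string_proj C (J n) a - string_proj C (J n) b)) \<le> w n * norm (a - b)"
      using w_nonneg[OF n] by (simp add: mult_left_mono)
  qed
  also have "\<dots> = norm (a - b)"
    using w_sum by (simp add: sum_distrib_right[symmetric])
  finally show ?thesis .
qed

context
  fixes \<omega> m :: real and z :: 'a
  assumes z: "z \<in> (\<Inter>i\<in>I. C i)"
    and \<omega>: "0 < \<omega>" "\<omega> \<le> 1" "\<And>n. n \<in> {1..N} \<Longrightarrow> \<omega> \<le> w n"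
    and m: "0 \<le> m" "\<And>n. n \<in> {1..N} \<Longrightarrow> real (length (J n)) \<le> m"
begin

text \<open>The decrease of the squared distance to \<open>z\<close> along the \<open>n\<close>-th string.\<close>

private definition E where
  "E a n = (norm (a - z))\<^sup>2 - (norm (string_proj C (J n) a - z))\<^sup>2"

private lemma E_bounds:
  assumes "n \<in> {1..N}"
  shows "0 \<le> E a n" "(norm (string_proj C (J n) a - a))\<^sup>2 \<le> m * E a n"
    "j \<in> set (J n) \<Longrightarrow> (infdist a (C j))\<^sup>2 \<le> m * E a n"
proof -
  have C': "\<And>j. j \<in> set (J n) \<Longrightarrow> closed (C j) \<and> convex (C j) \<and> z \<in> C j"
    using C J[OF assms] z by blast
  note dec = string_proj_decrease[of "J n" C z, OF C', of a, folded E_def]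
  show "0 \<le> E a n" by (rule dec(1))
  then have "real (length (J n)) * E a n \<le> m * E a n"
    by (intro mult_right_mono m assms)
  then show "(norm (string_proj C (J n) a - a))\<^sup>2 \<le> m * E a n"
    "j \<in> set (J n) \<Longrightarrow> (infdist a (C j))\<^sup>2 \<le> m * E a n"
    using dec(2,3) by (auto intro: order_trans)
qed

private lemma sum_E_le:
  "(\<Sum>n=1..N. w n * E a n) \<le> (norm (a - z))\<^sup>2 - (norm (string_average C N J w a - z))\<^sup>2"
proof -
  have "(norm (string_average C N J w a - z))\<^sup>2 \<le>
      (\<Sum>n=1..N. w n * (norm (string_proj C (J n) a - z))\<^sup>2)"
    unfolding string_average_diff by (rule norm_sq_convex_combination_le[OF w_nonneg w_sum])
  moreover have "(\<Sum>n=1..N. w n * E a n) = (\<Sum>n=1..N. w n) * (norm (a - z))\<^sup>2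
      - (\<Sum>n=1..N. w n * (norm (string_proj C (J n) a - z))\<^sup>2)"
    by (simp add: E_def right_diff_distrib sum_subtractf sum_distrib_right)
  ultimately show ?thesis
    using w_sum by simp
qed

lemma string_average_proximity:
  assumes n: "n \<in> {1..N}" and j: "j \<in> set (J n)"
  shows "(infdist a (C j))\<^sup>2 \<le>
    m / \<omega> * ((norm (a - z))\<^sup>2 - (norm (string_average C N J w a - z))\<^sup>2)"
proof -
  have "\<omega> * E a n \<le> w n * E a n"
    by (intro mult_right_mono \<omega> E_bounds n)
  also have "\<dots> \<le> (\<Sum>n=1..N. w n * E a n)"
    using n w_nonneg E_bounds(1) by (intro member_le_sum mult_nonneg_nonneg) auto
  also note sum_E_le
  finally have "E a n \<le> ((norm (a - z))\<^sup>2 - (norm (string_average C N J w a - z))\<^sup>2) / \<omega>"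
    using \<omega>(1) by (simp add: field_simps)
  then have "m * E a n \<le> m * (((norm (a - z))\<^sup>2 - (norm (string_average C N J w a - z))\<^sup>2) / \<omega>)"
    by (rule mult_left_mono[OF _ m(1)])
  then show ?thesis
    using E_bounds(3)[OF n j, of a] by simp
qed

lemma string_average_displacement:
  "(norm (string_average C N J w a - a))\<^sup>2 \<le>
    m / \<omega> * ((norm (a - z))\<^sup>2 - (norm (string_average C N J w a - z))\<^sup>2)"
proof -
  let ?D = "(norm (a - z))\<^sup>2 - (norm (string_average C N J w a - z))\<^sup>2"
  have "0 \<le> (\<Sum>n=1..N. w n * E a n)"
    using w_nonneg E_bounds(1) by (intro sum_nonneg mult_nonneg_nonneg) auto
  then have D0: "0 \<le> ?D"
    using sum_E_le[of a] by linarith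
  have "(norm (string_average C N J w a - a))\<^sup>2 \<le>
      (\<Sum>n=1..N. w n * (norm (string_proj C (J n) a - a))\<^sup>2)"
    unfolding string_average_diff by (rule norm_sq_convex_combination_le[OF w_nonneg w_sum])
  also have "\<dots> \<le> (\<Sum>n=1..N. w n * (m * E a n))"
    using w_nonneg E_bounds(2) by (intro sum_mono mult_left_mono) auto
  also have "\<dots> = m * (\<Sum>n=1..N. w n * E a n)"
    by (simp add: sum_distrib_left mult.left_commute)
  also have "\<dots> \<le> m * ?D"
    by (rule mult_left_mono[OF sum_E_le m(1)])
  also have "\<dots> \<le> m / \<omega> * ?D"
  proof (rule mult_right_mono[OF _ D0])
    show "m \<le> m / \<omega>"
      using \<omega>(1,2) m(1) mult_left_mono[of \<omega> 1 m] by (simp add: field_simps)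
  qed
  finally show ?thesis .
qed

end

end

section \<open>Superiorized string averaging projections\<close>

theorem corollary19:
  fixes C :: "nat \<Rightarrow> 'a::{real_inner,complete_space} set"
    and M s :: nat
    and I :: "nat set"
    and N :: "nat \<Rightarrow> nat"
    and J :: "nat \<Rightarrow> nat \<Rightarrow> nat list"
    and w :: "nat \<Rightarrow> nat \<Rightarrow> real"
    and \<omega> :: real
    and T :: "nat \<Rightarrow> 'a \<Rightarrow> 'a"
    and x v :: "nat \<Rightarrow> 'a"
    and \<beta> :: "nat \<Rightarrow> real"
  assumes "M \<ge> 1" and I: "I = {1..M}"
    and "\<And>i. i \<in> I \<Longrightarrow> closed (C i)"
    and "\<And>i. i \<in> I \<Longrightarrow> convex (C i)"
    and "(\<Inter>i\<in>I. C i) \<noteq> {}"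
    and T: "\<And>k. T k = string_average C (N k) (J k) (w k)"
    and "\<And>k n. n \<in> {1..N k} \<Longrightarrow> set (J k n) \<subseteq> I"
    and "\<And>k n. n \<in> {1..N k} \<Longrightarrow> w k n \<in> {0<..<1}"
    and "\<And>k. (\<Sum>n=1..N k. w k n) = 1"
    and "\<omega> > 0"
    and "\<And>k n. n \<in> {1..N k} \<Longrightarrow> w k n \<ge> \<omega>"
    and "bdd_above {length (J k n) |k n. n \<in> {1..N k}}"
    and "s \<ge> 1"
    and "\<And>k. I = (\<Union>l\<in>{k..k+s-1}. \<Union>n\<in>{1..N l}. set (J l n))"
    and "\<And>k. x (Suc k) = T k (x k - \<beta> k *\<^sub>R v k)"
    and "\<And>k. \<beta> k \<ge> 0" and "summable \<beta>"
    and "bounded (range v)"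
  shows
    "(\<exists>xinf xlim.
        xinf \<in> (\<Inter>i\<in>I. C i) \<and> (\<forall>i. xlim i \<in> (\<Inter>i\<in>I. C i)) \<and>
        (\<forall>i. weakly_converges (\<lambda>k. iterate_ops T k i (x i)) (xlim i)) \<and>
        xlim \<longlonglongrightarrow> xinf \<and>
        (\<forall>y k i. i \<le> k \<longrightarrow>
           \<bar>y \<bullet> (x (k+1) - xinf)\<bar> \<le> \<bar>y \<bullet> (iterate_ops T k i (x i) - xlim i)\<bar>
             + 2 * norm y * (\<Sum>j. \<beta> (i+j) * norm (v (i+j)))))
     \<and>
     (boundedly_regular I C \<longrightarrow>
       (\<exists>xinf xlim.
          xinf \<in> (\<Inter>i\<in>I. C i) \<and> (\<forall>i. xlim i \<in> (\<Inter>i\<in>I. C i)) \<and>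
          (\<forall>i. (\<lambda>k. iterate_ops T k i (x i)) \<longlonglongrightarrow> xlim i) \<and>
          xlim \<longlonglongrightarrow> xinf \<and>
          (\<forall>k i. i \<le> k \<longrightarrow>
             norm (x (k+1) - xinf) \<le> norm (iterate_ops T k i (x i) - xlim i)
               + 2 * (\<Sum>j. \<beta> (i+j) * norm (v (i+j))))))
     \<and>
     (boundedly_linearly_regular I C \<longrightarrow>
       (\<exists>\<kappa> c q xinf.
          \<kappa> > 0 \<and> c > 0 \<and> q \<in> {0<..<1} \<and> xinf \<in> (\<Inter>i\<in>I. C i) \<and>
          (\<forall>k i. i \<le> k \<longrightarrow>
             1 / (2 * \<kappa>) * norm (x (k+1) - xinf) - 2 * (\<Sum>j. \<beta> (i+j) * norm (v (i+j)))
               \<le> max_dist I C (x (k+1))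
             \<and> max_dist I C (x (k+1))
               \<le> c * q ^ (k - i) + 2 * (\<Sum>j. \<beta> (i+j) * norm (v (i+j))))))"
proof -
  obtain L where L: "\<And>k n. n \<in> {1..N k} \<Longrightarrow> length (J k n) \<le> L"
    using assms(12) unfolding bdd_above_def by blast
  \<comment> \<open>\<open>L + 1\<close> rather than \<open>L\<close>, so that \<open>m / \<omega>\<close> is positive.\<close>
  define m where "m = real (L + 1)"
  have m: "0 < m" "\<And>k n. n \<in> {1..N k} \<Longrightarrow> real (length (J k n)) \<le> m"
    using L by (force simp: m_def)+
  have w_nonneg: "0 \<le> w k n" if "n \<in> {1..N k}" for k n
    using assms(8)[OF that] by simp
  have \<omega>1: "\<omega> \<le> 1"
  proof -
    have "{1..N 0} \<noteq> {}"
      using assms(9)[of 0] by force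
    then obtain n where "n \<in> {1..N 0}" by blast
    then show ?thesis
      using assms(8)[of n 0] assms(11)[of n 0] by simp
  qed
  define e where "e k = \<beta> k * norm (v k)" for k
  obtain V where V: "\<And>k. norm (v k) \<le> V"
    using assms(18) unfolding bounded_iff by blast
  interpret inexact_orbit C I T "\<lambda>k. \<Union>n\<in>{1..N k}. set (J k n)" "m / \<omega>" s x e
  proof
    show "I \<subseteq> (\<Union>l\<in>{k..<k + s}. \<Union>n\<in>{1..N l}. set (J l n))" for k
    proof -
      have "{k..k + s - 1} = {k..<k + s}"
        using \<open>s \<ge> 1\<close> by auto
      then show ?thesis
        using assms(14)[of k] by simp
    qed
    show nonexp: "norm (T k a - T k b) \<le> norm (a - b)" for k a b
      unfolding T by (rule string_average_nonexpansive[OF assms(3-5,7) w_nonneg assms(9)])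
    show "(norm (T k a - a))\<^sup>2 \<le> m / \<omega> * ((norm (a - z))\<^sup>2 - (norm (T k a - z))\<^sup>2)"
      if "z \<in> (\<Inter>i\<in>I. C i)" for k a z
      unfolding T using m(1)
      by (intro string_average_displacement[OF assms(3-5,7) w_nonneg assms(9) that
            \<open>\<omega> > 0\<close> \<omega>1 assms(11) _ m(2)]) auto
    show "(infdist a (C j))\<^sup>2 \<le> m / \<omega> * ((norm (a - z))\<^sup>2 - (norm (T k a - z))\<^sup>2)"
      if "z \<in> (\<Inter>i\<in>I. C i)" "j \<in> (\<Union>n\<in>{1..N k}. set (J k n))" for k a z j
    proof -
      obtain n where "n \<in> {1..N k}" "j \<in> set (J k n)"
        using \<open>j \<in> _\<close> by blast
      then show ?thesis
        unfolding T using m(1)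
        by (intro string_average_proximity[OF assms(3-5,7) w_nonneg assms(9) that(1)
              \<open>\<omega> > 0\<close> \<omega>1 assms(11) _ m(2)]) auto
    qed
    show "norm (x (Suc k) - T k (x k)) \<le> e k" for k
      using nonexp[of k "x k - \<beta> k *\<^sub>R v k" "x k"] \<open>\<beta> k \<ge> 0\<close>
      by (simp add: assms(15) e_def)
    show "summable e"
    proof (rule summable_comparison_test')
      show "summable (\<lambda>k. \<beta> k * V)"
        by (rule summable_mult2[OF \<open>summable \<beta>\<close>])
      show "norm (e k) \<le> \<beta> k * V" for k
        using V[of k] \<open>\<beta> k \<ge> 0\<close> by (simp add: e_def mult_left_mono)
    qed
  qed (use assms m(1) in auto)
  have tail: "(\<Sum>j. \<beta> (i+j) * norm (v (i+j))) = tail i" for i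
    by (simp add: tail_def e_def)
  obtain xinf xlim where lims: "xinf \<in> Z" "\<forall>i. xlim i \<in> Z"
    "\<forall>i. weakly_converges (\<lambda>k. iterate_ops T k i (x i)) (xlim i)"
    "boundedly_regular I C \<longrightarrow> (\<forall>i. (\<lambda>k. iterate_ops T k i (x i)) \<longlonglongrightarrow> xlim i)"
    "xlim \<longlonglongrightarrow> xinf"
    "\<forall>y k i. i \<le> k \<longrightarrow> \<bar>y \<bullet> (x (k+1) - xinf)\<bar> \<le>
        \<bar>y \<bullet> (iterate_ops T k i (x i) - xlim i)\<bar> + 2 * norm y * tail i"
    "\<forall>k i. i \<le> k \<longrightarrow> norm (x (k+1) - xinf) \<le>
        norm (iterate_ops T k i (x i) - xlim i) + 2 * tail i"
    using weak_limits by blast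
  show ?thesis
    unfolding tail Z_def[symmetric]
  proof (intro conjI impI)
    show "\<exists>xinf xlim. xinf \<in> Z \<and> (\<forall>i. xlim i \<in> Z) \<and>
        (\<forall>i. weakly_converges (\<lambda>k. iterate_ops T k i (x i)) (xlim i)) \<and> xlim \<longlonglongrightarrow> xinf \<and>
        (\<forall>y k i. i \<le> k \<longrightarrow> \<bar>y \<bullet> (x (k+1) - xinf)\<bar> \<le>
           \<bar>y \<bullet> (iterate_ops T k i (x i) - xlim i)\<bar> + 2 * norm y * tail i)"
      using lims(1-3,5,6) by (intro exI[of _ xinf] exI[of _ xlim] conjI)
    show "\<exists>xinf xlim. xinf \<in> Z \<and> (\<forall>i. xlim i \<in> Z) \<and>
        (\<forall>i. (\<lambda>k. iterate_ops T k i (x i)) \<longlonglongrightarrow> xlim i) \<and> xlim \<longlonglongrightarrow> xinf \<and>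
        (\<forall>k i. i \<le> k \<longrightarrow> norm (x (k+1) - xinf) \<le>
           norm (iterate_ops T k i (x i) - xlim i) + 2 * tail i)"
      if "boundedly_regular I C"
      using lims(1,2,5,7) lims(4)[rule_format, OF that]
      by (intro exI[of _ xinf] exI[of _ xlim] conjI allI) auto
  qed (rule linear_rate)
qed

end
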